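(* Let $M$ be a closed $n$-manifold with an effective homologically injective action of the torus $T^k$ ($k\ge1$). Then for every $j$, ${k\choose j}\le b_j(M)$, where $b_j(M)=\operatorname{rank}H_j(M;\mathbb{Z})$. In particular $2^k\le\sum_{j=0}^n b_j(M)$ (the Halperin–Carlsson inequality holds).
   Context: For an effective $T^k$-action on $M$ and $x\in M$, the orbit map is $\mathrm{ev}:T^k\to M$, $\mathrm{ev}(t)=tx$. The action is homologically injective if the induced map $\mathrm{ev}_*:H_1(T^k;\mathbb{Z})=\mathbb{Z}^k\to H_1(M;\mathbb{Z})$ is injective (this is independent of $x$). *)

theory Defs
  imports "HOL-Analysis.Analysis" "HOL-Algebra.Free_Abelian_Groups" "HOL-Algebra.Coset"
    "HOL-Library.Extended_Nat"
begin

section \<open>Singular homology with integer coefficients (definitions as in HOL-Homology)\<close>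

type_synonym 'a chain = "((nat \<Rightarrow> real) \<Rightarrow> 'a) \<Rightarrow>\<^sub>0 int"

definition standard_simplex :: "nat \<Rightarrow> (nat \<Rightarrow> real) set" where
  "standard_simplex p \<equiv>
    {x. (\<forall>i. 0 \<le> x i \<and> x i \<le> 1) \<and> (\<forall>i>p. x i = 0) \<and> (\<Sum>i\<le>p. x i) = 1}"

definition simplical_face :: "nat \<Rightarrow> (nat \<Rightarrow> 'a) \<Rightarrow> nat \<Rightarrow> 'a::comm_monoid_add" where
   "simplical_face k x \<equiv> \<lambda>i. if i < k then x i else if i = k then 0 else x(i -1)"

definition singular_simplex :: "nat \<Rightarrow> 'a topology \<Rightarrow> ((nat \<Rightarrow> real) \<Rightarrow> 'a) \<Rightarrow> bool" where
 "singular_simplex p X f \<equiv>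
      continuous_map(subtopology (powertop_real UNIV) (standard_simplex p)) X f
    \<and> f \<in> extensional (standard_simplex p)"

abbreviation singular_simplex_set :: "nat \<Rightarrow> 'a topology \<Rightarrow> ((nat \<Rightarrow> real) \<Rightarrow> 'a) set" where
 "singular_simplex_set p X \<equiv> Collect (singular_simplex p X)"

definition singular_face :: "nat \<Rightarrow> nat \<Rightarrow> ((nat \<Rightarrow> real) \<Rightarrow> 'a) \<Rightarrow> (nat \<Rightarrow> real) \<Rightarrow> 'a"
  where "singular_face p k f \<equiv> restrict (f \<circ> simplical_face k) (standard_simplex (p - Suc 0))"

definition singular_chain :: "[nat, 'a topology, 'a chain] \<Rightarrow> bool"
  where "singular_chain p X c \<equiv> Poly_Mapping.keys c \<subseteq> singular_simplex_set p X"

abbreviation singular_chain_set :: "[nat, 'a topology] \<Rightarrow> ('a chain) set"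
  where "singular_chain_set p X \<equiv> Collect (singular_chain p X)"

definition chain_boundary :: "nat \<Rightarrow> ('a chain) \<Rightarrow> 'a chain"
  where "chain_boundary p c \<equiv>
          (if p = 0 then 0 else
           frag_extend (\<lambda>f. (\<Sum>k\<le>p. frag_cmul ((-1) ^ k) (frag_of(singular_face p k f)))) c)"

definition mod_subset
  where "mod_subset p X \<equiv> {(a,b). singular_chain p X (a - b)}"

definition singular_relcycle :: "nat \<Rightarrow> 'a topology \<Rightarrow> 'a set \<Rightarrow> ('a chain) \<Rightarrow> bool"
  where "singular_relcycle \<equiv>
        \<lambda>p X S c. singular_chain p X c \<and> (chain_boundary p c, 0) \<in> mod_subset (p-1) (subtopology X S)"

definition singular_relboundary :: "nat \<Rightarrow> 'a topology \<Rightarrow> 'a set \<Rightarrow> ('a chain) \<Rightarrow> bool"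
  where
  "singular_relboundary p X S \<equiv>
    \<lambda>c. \<exists>d. singular_chain (Suc p) X d \<and> (chain_boundary (Suc p) d, c) \<in> (mod_subset p (subtopology X S))"

abbreviation singular_relboundary_set :: "nat \<Rightarrow> 'a topology \<Rightarrow> 'a set \<Rightarrow> ('a chain) set"
  where "singular_relboundary_set p X S \<equiv> Collect (singular_relboundary p X S)"

definition simplex_map :: "nat \<Rightarrow> ('b \<Rightarrow> 'a) \<Rightarrow> ((nat \<Rightarrow> real) \<Rightarrow> 'b) \<Rightarrow> (nat \<Rightarrow> real) \<Rightarrow> 'a"
  where "simplex_map p g c \<equiv> restrict (g \<circ> c) (standard_simplex p)"

definition chain_map :: "nat \<Rightarrow> ('b \<Rightarrow> 'a) \<Rightarrow> (((nat \<Rightarrow> real) \<Rightarrow> 'b) \<Rightarrow>\<^sub>0 int) \<Rightarrow> 'a chain"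
  where "chain_map p g c \<equiv> frag_extend (frag_of \<circ> simplex_map p g) c"

definition chain_group :: "nat \<Rightarrow> 'a topology \<Rightarrow> 'a chain monoid"
  where "chain_group p X \<equiv> free_Abelian_group (singular_simplex_set p X)"

definition relcycle_group :: "nat \<Rightarrow> 'a topology \<Rightarrow> 'a set \<Rightarrow> ('a chain) monoid"
  where "relcycle_group p X S \<equiv>
        subgroup_generated (chain_group p X) (Collect(singular_relcycle p X S))"

definition homology_group :: "nat \<Rightarrow> 'a topology \<Rightarrow> ('a chain) set monoid"
  where "homology_group p X \<equiv> (relcycle_group p X {}) Mod (singular_relboundary_set p X {})"

definition hom_induced :: "nat \<Rightarrow> 'b topology \<Rightarrow> 'a topology \<Rightarrow> ('b \<Rightarrow> 'a)
    \<Rightarrow> ('b chain) set \<Rightarrow> ('a chain) set"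
  where "hom_induced p X Y f C \<equiv>
     r_coset (relcycle_group p Y {}) (singular_relboundary_set p Y {}) (chain_map p f (SOME c. c \<in> C))"

definition Z_independent :: "('g, 'm) monoid_scheme \<Rightarrow> 'g set \<Rightarrow> bool" where
  "Z_independent G S \<equiv> finite S \<and> S \<subseteq> carrier G \<and>
     (\<forall>a :: 'g \<Rightarrow> int. finprod G (\<lambda>s. s [^]\<^bsub>G\<^esub> a s) S = \<one>\<^bsub>G\<^esub> \<longrightarrow> (\<forall>s\<in>S. a s = 0))"

definition group_rank :: "('g, 'm) monoid_scheme \<Rightarrow> enat" where
  "group_rank G \<equiv> Sup ((\<lambda>S. enat (card S)) ` {S. Z_independent G S})"

definition betti :: "nat \<Rightarrow> 'a topology \<Rightarrow> enat" where
  "betti j X \<equiv> group_rank (homology_group j X)"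

definition closed_manifold :: "nat \<Rightarrow> 'a topology \<Rightarrow> bool" where
  "closed_manifold n X \<equiv> compact_space X \<and> Hausdorff_space X \<and> second_countable X \<and>
     (\<forall>x\<in>topspace X. \<exists>U. openin X U \<and> x \<in> U \<and>
         (subtopology X U) homeomorphic_space (Euclidean_space n))"

definition torus_set :: "nat \<Rightarrow> (nat \<Rightarrow> complex) set" where
  "torus_set k \<equiv> {z. (\<forall>i<k. norm (z i) = 1) \<and> (\<forall>i\<ge>k. z i = 1)}"

definition torus :: "nat \<Rightarrow> (nat \<Rightarrow> complex) topology" where
  "torus k \<equiv> subtopology (product_topology (\<lambda>i. euclidean) UNIV) (torus_set k)"

definition torus_mult :: "(nat \<Rightarrow> complex) \<Rightarrow> (nat \<Rightarrow> complex) \<Rightarrow> nat \<Rightarrow> complex" where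
  "torus_mult s t \<equiv> \<lambda>i. s i * t i"

definition torus_one :: "nat \<Rightarrow> complex" where
  "torus_one \<equiv> \<lambda>i. 1"

definition torus_action :: "nat \<Rightarrow> 'a topology \<Rightarrow> ((nat \<Rightarrow> complex) \<Rightarrow> 'a \<Rightarrow> 'a) \<Rightarrow> bool" where
  "torus_action k X act \<equiv>
     continuous_map (prod_topology (torus k) X) X (\<lambda>(t, x). act t x) \<and>
     (\<forall>x\<in>topspace X. act torus_one x = x) \<and>
     (\<forall>s\<in>torus_set k. \<forall>t\<in>torus_set k. \<forall>x\<in>topspace X.
         act (torus_mult s t) x = act s (act t x))"

definition effective_action :: "nat \<Rightarrow> 'a topology \<Rightarrow> ((nat \<Rightarrow> complex) \<Rightarrow> 'a \<Rightarrow> 'a) \<Rightarrow> bool" where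
  "effective_action k X act \<equiv>
     (\<forall>t\<in>torus_set k. (\<forall>x\<in>topspace X. act t x = x) \<longrightarrow> t = torus_one)"

text \<open>Homologically injective: for the orbit map \<open>ev(t) = t x\<close>, \<open>ev_* : H_1(T^k) \<rightarrow> H_1(X)\<close>
  is injective (the paper notes this does not depend on the point \<open>x\<close>).\<close>
definition homologically_injective :: "nat \<Rightarrow> 'a topology \<Rightarrow> ((nat \<Rightarrow> complex) \<Rightarrow> 'a \<Rightarrow> 'a) \<Rightarrow> 'a \<Rightarrow> bool" where
  "homologically_injective k X act x \<equiv>
     inj_on (hom_induced 1 (torus k) X (\<lambda>t. act t x)) (carrier (homology_group 1 (torus k)))"

end

theory Submission
  imports Defs "HOL-Homology.Homology"
begin

text \<open>
  Write \<open>e v\<close> for the point \<open>exp(2\<pi>iv) x0\<close> of the orbit, \<open>v \<in> \<real>^k\<close>. The coordinate loops of the torus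
  are independent in its first homology, as seen by counting windings, so homological injectivity and
  divisibility of the rationals give rational 1-cocycles \<open>\<phi> 0, \<dots>, \<phi> (k - 1)\<close> on \<open>X\<close> dual to the
  corresponding orbit loops. For a \<open>j\<close>-subset \<open>A\<close> of the coordinates, the image under \<open>e\<close> of the unit cube in the
  directions \<open>A\<close>, cut into \<open>j!\<close> simplices indexed by permutations, is a cycle, and the cup
  products of the \<open>\<phi> i\<close> over \<open>j\<close>-subsets are dual to these cycles. Hence \<open>k choose j \<le> b_j\<close>.

  The sum of the Betti numbers stops at the dimension \<open>n\<close>, so \<open>k \<le> n\<close> is also needed. The loops
  \<open>t \<mapsto> e (t v)\<close> with \<open>e v = x0\<close> depend additively on \<open>v\<close> in homology, are nontrivial for \<open>v\<close> in
  \<open>\<int>^k - {0}\<close>, and vanish for small \<open>v\<close>. By simultaneous Dirichlet approximation this forces the stabilizer to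
  be discrete, so \<open>e\<close> is locally injective and invariance of domain applies.
\<close>

text \<open>The definitions of HOL-Homology are duplicated verbatim in Defs;
  below, unqualified names refer to HOL-Homology.\<close>

hide_const (open) Defs.standard_simplex Defs.simplical_face Defs.singular_simplex
  Defs.singular_simplex_set Defs.singular_face Defs.singular_chain Defs.singular_chain_set
  Defs.chain_boundary Defs.mod_subset Defs.singular_relcycle Defs.singular_relboundary
  Defs.singular_relboundary_set Defs.simplex_map Defs.chain_map Defs.chain_group
  Defs.relcycle_group Defs.homology_group Defs.hom_induced
hide_fact (open) Defs.standard_simplex_def Defs.simplical_face_def Defs.singular_simplex_def
  Defs.singular_face_def Defs.singular_chain_def
  Defs.chain_boundary_def Defs.mod_subset_def Defs.singular_relcycle_def
  Defs.singular_relboundary_def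
  Defs.simplex_map_def Defs.chain_map_def Defs.chain_group_def
  Defs.relcycle_group_def Defs.homology_group_def Defs.hom_induced_def
hide_type (open) Defs.chain

lemma standard_simplex_Defs: "Defs.standard_simplex = standard_simplex"
  by (simp add: fun_eq_iff Defs.standard_simplex_def standard_simplex_def)

lemma singular_simplex_Defs: "Defs.singular_simplex = singular_simplex"
  by (simp add: fun_eq_iff Defs.singular_simplex_def singular_simplex_def standard_simplex_Defs)

lemma singular_face_Defs: "Defs.singular_face = singular_face"
  by (simp add: fun_eq_iff Defs.singular_face_def singular_face_def standard_simplex_Defs
      Defs.simplical_face_def simplical_face_def o_def)

lemma singular_chain_Defs: "Defs.singular_chain = singular_chain"
  by (simp add: fun_eq_iff Defs.singular_chain_def singular_chain_def singular_simplex_Defs)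

lemma chain_boundary_Defs: "Defs.chain_boundary = chain_boundary"
  by (simp add: fun_eq_iff Defs.chain_boundary_def chain_boundary_def singular_face_Defs)

lemma mod_subset_Defs: "Defs.mod_subset = mod_subset"
  by (simp add: fun_eq_iff Defs.mod_subset_def mod_subset_def singular_chain_Defs)

lemma singular_relcycle_Defs: "Defs.singular_relcycle = singular_relcycle"
  by (simp add: fun_eq_iff Defs.singular_relcycle_def singular_relcycle_def singular_chain_Defs
      mod_subset_Defs chain_boundary_Defs)

lemma singular_relboundary_Defs: "Defs.singular_relboundary = singular_relboundary"
  by (simp add: fun_eq_iff Defs.singular_relboundary_def singular_relboundary_def
      singular_chain_Defs mod_subset_Defs chain_boundary_Defs)

lemma chain_map_Defs: "Defs.chain_map = chain_map"
  by (simp add: fun_eq_iff Defs.chain_map_def chain_map_def Defs.simplex_map_def simplex_map_def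
      standard_simplex_Defs o_def)

lemma relcycle_group_Defs: "Defs.relcycle_group = relcycle_group"
  by (simp add: fun_eq_iff Defs.relcycle_group_def relcycle_group_def Defs.chain_group_def
      chain_group_def singular_simplex_Defs singular_relcycle_Defs)

lemma homology_group_Defs: "Defs.homology_group p X = homology_group (int p) X"
  by (simp add: Defs.homology_group_def relative_homology_group_def relcycle_group_Defs
      singular_relboundary_Defs)

lemma hom_induced_Defs:
  "Defs.hom_induced p X Y f C = homologous_rel_set p Y {} (chain_map p f (SOME c. c \<in> C))"
  by (simp add: Defs.hom_induced_def relcycle_group_Defs
      singular_relboundary_Defs chain_map_Defs right_coset_singular_relboundary)

section \<open>Independent homology classes and functionals\<close>

text \<open>Applying \<open>h i\<close> to a multiplicative relation among the \<open>g l\<close>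
  isolates the exponent of \<open>g i\<close>. Duality also makes \<open>g\<close> injective, so
  \<open>I\<close> and its image have the same size.\<close>

lemma group_rank_ge:
  fixes G (structure) and h :: "'i \<Rightarrow> 'g \<Rightarrow> rat"
  assumes G: "comm_group G" and I: "finite I"
    and g: "\<And>i. i \<in> I \<Longrightarrow> g i \<in> carrier G"
    and h: "\<And>i x y. \<lbrakk>i \<in> I; x \<in> carrier G; y \<in> carrier G\<rbrakk> \<Longrightarrow> h i (x \<otimes> y) = h i x + h i y"
    and dual: "\<And>i l. \<lbrakk>i \<in> I; l \<in> I\<rbrakk> \<Longrightarrow> h i (g l) = (if i = l then 1 else 0)"
  shows "enat (card I) \<le> group_rank G"
proof -
  interpret comm_group G by fact
  have inj: "inj_on g I"
    using dual by (metis inj_onI zero_neq_one)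
  have h1: "h i \<one> = 0" if "i \<in> I" for i
    using h[OF that, of \<one> \<one>] by simp
  have hpow: "h i (x [^] (n::nat)) = of_nat n * h i x" if "i \<in> I" "x \<in> carrier G" for i x n
    by (induction n) (use that h1 h in \<open>auto simp: algebra_simps\<close>)
  have hinv: "h i (inv x) = - h i x" if "i \<in> I" "x \<in> carrier G" for i x
    using h[of i x "inv x"] h1 that by (simp add: add_eq_0_iff)
  have hipow: "h i (x [^] (n::int)) = of_int n * h i x" if "i \<in> I" "x \<in> carrier G" for i x n
    using that hpow hinv by (cases n rule: int_cases2) (auto simp: int_pow_int int_pow_neg)
  have hprod: "h i (finprod G f S) = (\<Sum>s\<in>S. h i (f s))"
    if "i \<in> I" "finite S" "f \<in> S \<rightarrow> carrier G" for i f S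
    using that(2,3) by (induction S rule: finite_induct) (use h h1 that(1) in \<open>auto simp: finprod_insert\<close>)
  have "Z_independent G (g ` I)"
    unfolding Z_independent_def
  proof (intro conjI allI impI ballI)
    fix a :: "'g \<Rightarrow> int" and s
    assume eq: "(\<Otimes>s\<in>g ` I. s [^] a s) = \<one>" and "s \<in> g ` I"
    then obtain i where i: "i \<in> I" "s = g i" by blast
    have "0 = h i (\<Otimes>s\<in>g ` I. s [^] a s)"
      using eq h1 i by simp
    also have "\<dots> = (\<Sum>s\<in>g ` I. h i (s [^] a s))"
      by (rule hprod) (use i I g in auto)
    also have "\<dots> = (\<Sum>l\<in>I. h i (g l [^] a (g l)))"
      by (simp add: sum.reindex[OF inj])
    also have "\<dots> = (\<Sum>l\<in>I. if l = i then of_int (a (g l)) else 0)"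
      by (rule sum.cong) (use hipow g i dual in auto)
    also have "\<dots> = of_int (a s)"
      using i I by simp
    finally show "a s = 0" by simp
  qed (use I g in auto)
  then have "enat (card (g ` I)) \<le> group_rank G"
    unfolding group_rank_def by (intro Sup_upper) auto
  then show ?thesis
    by (simp add: card_image inj)
qed

text \<open>Passes from chains to homology: an additive function that vanishes on boundaries is
  constant on homology classes, so duality on cycles becomes duality on classes.\<close>

lemma betti_ge:
  fixes F :: "'i \<Rightarrow> 'a chain \<Rightarrow> rat"
  assumes I: "finite I"
    and cyc: "\<And>i. i \<in> I \<Longrightarrow> singular_relcycle p X {} (c i)"
    and add: "\<And>i a b. i \<in> I \<Longrightarrow> F i (a + b) = F i a + F i b"
    and bd: "\<And>i b. \<lbrakk>i \<in> I; singular_relboundary p X {} b\<rbrakk> \<Longrightarrow> F i b = 0"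
    and dual: "\<And>i l. \<lbrakk>i \<in> I; l \<in> I\<rbrakk> \<Longrightarrow> F i (c l) = (if i = l then 1 else 0)"
  shows "enat (card I) \<le> betti p X"
proof -
  let ?G = "homology_group (int p) X"
  \<comment> \<open>The functional on a class is read off a chosen representative;
    \<open>same\<close> shows that the choice does not matter.\<close>
  define h where "h \<equiv> \<lambda>i C. F i (SOME c. c \<in> C)"
  have same: "F i a = F i b" if "i \<in> I" "homologous_rel p X {} a b" for i a b
    using add[of i "a - b" b] bd[of i "a - b"] that by (simp add: homologous_rel_def)
  have h: "h i C = F i a" if "i \<in> I" "C \<in> carrier ?G" "a \<in> C" for i C a
  proof -
    from that obtain b where b: "C = homologous_rel_set p X {} b"
      by (auto simp: carrier_relative_homology_group)
    have "(SOME c. c \<in> C) \<in> C"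
      using that(3) by (rule someI)
    then show ?thesis
      using same[OF that(1)] that(3) unfolding h_def b by (metis mem_Collect_eq)
  qed
  have ne: "\<exists>a. a \<in> C" if "C \<in> carrier ?G" for C
    using that by (auto simp: carrier_relative_homology_group intro: homologous_rel_refl)
  have "enat (card I) \<le> group_rank ?G"
  proof (rule group_rank_ge[where h = h and g = "\<lambda>i. homologous_rel_set p X {} (c i)", OF _ I])
    show G: "comm_group ?G" by (rule abelian_relative_homology_group)
    show inG: "homologous_rel_set p X {} (c i) \<in> carrier ?G" if "i \<in> I" for i
      using cyc that by (auto simp: carrier_relative_homology_group)
    show "h i (C \<otimes>\<^bsub>?G\<^esub> D) = h i C + h i D" if "i \<in> I" and C: "C \<in> carrier ?G" and D: "D \<in> carrier ?G" for i C D
    proof -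
      obtain a b where ab: "a \<in> C" "b \<in> D" using ne C D by metis
      have "a + b \<in> C \<otimes>\<^bsub>?G\<^esub> D"
        using ab by (auto simp: mult_relative_homology_group)
      moreover have "C \<otimes>\<^bsub>?G\<^esub> D \<in> carrier ?G"
        using C D G by (simp add: comm_group.axioms(2) group.is_monoid monoid.m_closed)
      ultimately show ?thesis
        using h ab that add by metis
    qed
    show "h i (homologous_rel_set p X {} (c l)) = (if i = l then 1 else 0)" if "i \<in> I" "l \<in> I" for i l
      using h[OF that(1) inG[OF that(2)], of "c l"] dual that by simp
  qed
  then show ?thesis
    by (simp add: betti_def homology_group_Defs)
qed

lemma additive_sum:
  fixes F :: "'a::ab_group_add \<Rightarrow> 'b::ab_group_add"
  assumes "\<And>x y. F (x + y) = F x + F y"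
  shows "F (\<Sum>i\<in>I. f i) = (\<Sum>i\<in>I. F (f i))"
proof -
  interpret additive F by standard (rule assms)
  show ?thesis by (rule sum)
qed

text \<open>In the quotient by a subgroup that is maximal among those meeting
  the multiples of \<open>g\<close> trivially, every element is commensurable with \<open>g\<close>.\<close>

lemma rational_functional:
  fixes B :: "('a \<Rightarrow>\<^sub>0 int) set" and g :: "'a \<Rightarrow>\<^sub>0 int"
  assumes B0: "0 \<in> B" and Bdiff: "\<And>a b. \<lbrakk>a \<in> B; b \<in> B\<rbrakk> \<Longrightarrow> a - b \<in> B"
    and g: "\<And>n. frag_cmul n g \<in> B \<Longrightarrow> n = 0"
  obtains F :: "('a \<Rightarrow>\<^sub>0 int) \<Rightarrow> rat"
  where "\<And>x y. F (x + y) = F x + F y" "\<And>b. b \<in> B \<Longrightarrow> F b = 0" "F g = 1"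
proof -
  \<comment> \<open>The subgroups (closed under differences) that contain \<open>B\<close> but no
    nonzero multiple of \<open>g\<close>, ordered by inclusion for Zorn's lemma.\<close>
  define A where "A \<equiv> {H. B \<subseteq> H \<and> (\<forall>a\<in>H. \<forall>b\<in>H. a - b \<in> H) \<and> (\<forall>n. frag_cmul n g \<in> H \<longrightarrow> n = 0)}"
  have "B \<in> A"
    using assms by (auto simp: A_def)
  have "\<exists>M\<in>A. \<forall>H\<in>A. M \<subseteq> H \<longrightarrow> H = M"
  proof (rule subset_Zorn_nonempty)
    fix C assume C: "C \<noteq> {}" "subset.chain A C"
    then have sub: "C \<subseteq> A" and lin: "\<And>x y. x \<in> C \<Longrightarrow> y \<in> C \<Longrightarrow> x \<subseteq> y \<or> y \<subseteq> x"
      by (auto simp: subset_chain_def)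
    have "a - b \<in> \<Union>C" if "a \<in> \<Union>C" "b \<in> \<Union>C" for a b
    proof -
      from that obtain x y where xy: "x \<in> C" "a \<in> x" "y \<in> C" "b \<in> y" by blast
      then obtain z where "z \<in> C" "a \<in> z" "b \<in> z" using lin by blast
      then show ?thesis using sub by (auto simp: A_def)
    qed
    moreover have "B \<subseteq> \<Union>C"
    proof -
      obtain x where "x \<in> C" using C(1) by blast
      moreover from this have "B \<subseteq> x" using sub by (auto simp: A_def)
      ultimately show ?thesis by blast
    qed
    moreover have "n = 0" if "frag_cmul n g \<in> \<Union>C" for n
      using that sub unfolding A_def by blast
    ultimately show "\<Union>C \<in> A"
      unfolding A_def by blast
  qed (use \<open>B \<in> A\<close> in blast)
  then obtain H where H: "H \<in> A" and max: "\<And>K. \<lbrakk>K \<in> A; H \<subseteq> K\<rbrakk> \<Longrightarrow> K = H"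
    by metis
  have BH: "B \<subseteq> H" and Hdiff: "\<And>a b. \<lbrakk>a \<in> H; b \<in> H\<rbrakk> \<Longrightarrow> a - b \<in> H"
    and Hg: "\<And>n. frag_cmul n g \<in> H \<Longrightarrow> n = 0"
    using H by (auto simp: A_def)
  have H0: "0 \<in> H" using BH B0 by blast
  have Hneg: "- a \<in> H" if "a \<in> H" for a
    using Hdiff[OF H0 that] by simp
  have Hadd: "a + b \<in> H" if "a \<in> H" "b \<in> H" for a b
    using Hdiff[OF that(1) Hneg[OF that(2)]] by simp
  have Hnat: "frag_cmul (int n) a \<in> H" if "a \<in> H" for n a
    by (induction n) (use H0 Hadd that in \<open>auto simp: frag_cmul_distrib\<close>)
  have Hcmul: "frag_cmul n a \<in> H" if "a \<in> H" for n a
    using Hnat[OF that] Hneg[OF Hnat[OF that]]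
    by (cases n rule: int_cases2) (auto simp: minus_frag_cmul)
  \<comment> \<open>Modulo \<open>H\<close>, \<open>m\<close> times \<open>x\<close> equals
    \<open>n\<close> times \<open>g\<close>, so the functional has to take the value
    \<open>n / m\<close> at \<open>x\<close>.\<close>
  define R where "R \<equiv> \<lambda>x m n. m \<noteq> 0 \<and> frag_cmul n g - frag_cmul m x \<in> H"
  have ex: "\<exists>m n. R x m n" for x
  proof (cases "x \<in> H")
    case True
    then show ?thesis
      by (intro exI[of _ 1] exI[of _ 0]) (simp add: R_def Hneg)
  next
    case False
    \<comment> \<open>The subgroup generated by \<open>H\<close> and \<open>x\<close>. As
      \<open>x\<close> lies outside \<open>H\<close>, maximality forces a nonzero multiple of
      \<open>g\<close> into \<open>K\<close>, which gives the wanted relation.\<close>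
    define K where "K \<equiv> {h + frag_cmul m x | h m. h \<in> H}"
    have HK: "H \<subseteq> K"
      unfolding K_def by (force intro: exI[of _ 0])
    have "x \<in> K"
      unfolding K_def using H0 by (force intro: exI[of _ 1])
    have "K \<notin> A"
      using max[OF _ HK] \<open>x \<in> K\<close> False by blast
    moreover have "B \<subseteq> K" using BH HK by blast
    moreover have "a - b \<in> K" if "a \<in> K" "b \<in> K" for a b
    proof -
      from that obtain h m h' m' where "a = h + frag_cmul m x" "h \<in> H" "b = h' + frag_cmul m' x" "h' \<in> H"
        by (auto simp: K_def)
      then have "a - b = (h - h') + frag_cmul (m - m') x" "h - h' \<in> H"
        using Hdiff by (auto simp: algebra_simps frag_cmul_diff_distrib)
      then show ?thesis unfolding K_def by blast
    qed
    ultimately obtain n where n: "frag_cmul n g \<in> K" "n \<noteq> 0"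
      by (auto simp: A_def)
    then obtain h m where hm: "frag_cmul n g = h + frag_cmul m x" "h \<in> H"
      by (auto simp: K_def)
    have "m \<noteq> 0"
      using hm n Hg by force
    then have "R x m n"
      using hm by (simp add: R_def)
    then show ?thesis by blast
  qed
  have uniq: "of_int n / of_int m = (of_int n' / of_int m' :: rat)" if "R x m n" "R x m' n'" for x m n m' n'
  proof -
    \<comment> \<open>Cross-multiplying eliminates \<open>x\<close> and leaves a multiple of
      \<open>g\<close> in \<open>H\<close>, which must be zero.\<close>
    have "frag_cmul m' (frag_cmul n g - frag_cmul m x) - frag_cmul m (frag_cmul n' g - frag_cmul m' x) \<in> H"
      using that Hcmul Hdiff by (simp add: R_def)
    moreover have "frag_cmul m' (frag_cmul n g - frag_cmul m x) - frag_cmul m (frag_cmul n' g - frag_cmul m' x)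
        = frag_cmul (m' * n - m * n') g"
      by (simp add: poly_mapping_eq_iff fun_eq_iff lookup_minus algebra_simps)
    ultimately have "m' * n = m * n'"
      using Hg by force
    then have "(of_int m' * of_int n :: rat) = of_int m * of_int n'"
      by (metis of_int_mult)
    then show ?thesis
      using that by (simp add: R_def field_simps)
  qed
  define F :: "('a \<Rightarrow>\<^sub>0 int) \<Rightarrow> rat" where "F \<equiv> \<lambda>x. SOME q. \<exists>m n. R x m n \<and> q = of_int n / of_int m"
  have F: "F x = of_int n / of_int m" if "R x m n" for x m n
  proof -
    have "\<exists>m n. R x m n \<and> F x = of_int n / of_int m"
      unfolding F_def by (rule someI_ex) (use that in blast)
    then show ?thesis
      using uniq that by metis
  qed
  show thesis
  proof
    fix x y
    obtain m n m' n' where R: "R x m n" "R y m' n'" using ex by meson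
    then have "frag_cmul m' (frag_cmul n g - frag_cmul m x) + frag_cmul m (frag_cmul n' g - frag_cmul m' y) \<in> H"
      using Hcmul Hadd by (simp add: R_def)
    moreover have "frag_cmul m' (frag_cmul n g - frag_cmul m x) + frag_cmul m (frag_cmul n' g - frag_cmul m' y)
       = frag_cmul (m' * n + m * n') g - frag_cmul (m * m') (x + y)"
      by (simp add: poly_mapping_eq_iff fun_eq_iff lookup_minus lookup_add algebra_simps)
    ultimately have "R (x + y) (m * m') (m' * n + m * n')"
      using R by (simp add: R_def)
    then have "F (x + y) = of_int (m' * n + m * n') / of_int (m * m')"
      by (rule F)
    moreover have "m \<noteq> 0" "m' \<noteq> 0"
      using R by (auto simp: R_def)
    ultimately show "F (x + y) = F x + F y"
      unfolding F[OF R(1)] F[OF R(2)] by (simp add: add_divide_distrib)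
  next
    fix b assume "b \<in> B"
    then have "R b 1 0"
      using BH Hneg by (auto simp: R_def)
    then show "F b = 0" using F by fastforce
  next
    have "R g 1 1" by (simp add: R_def H0)
    then show "F g = 1" using F by fastforce
  qed
qed

section \<open>Evaluation of cochains on chains, for rational and complex values alike\<close>

definition cochain_eval :: "('a \<Rightarrow> 'b::comm_ring_1) \<Rightarrow> ('a \<Rightarrow>\<^sub>0 int) \<Rightarrow> 'b" where
  "cochain_eval f c = (\<Sum>\<sigma>\<in>Poly_Mapping.keys c. of_int (Poly_Mapping.lookup c \<sigma>) * f \<sigma>)"

lemma cochain_eval_superset:
  assumes "finite S" "Poly_Mapping.keys c \<subseteq> S"
  shows "cochain_eval f c = (\<Sum>\<sigma>\<in>S. of_int (Poly_Mapping.lookup c \<sigma>) * f \<sigma>)"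
  unfolding cochain_eval_def
  by (rule sum.mono_neutral_left) (use assms in \<open>auto simp: in_keys_iff\<close>)

lemma cochain_eval_add: "cochain_eval f (a + b) = cochain_eval f a + cochain_eval f b"
proof -
  define S where "S = Poly_Mapping.keys a \<union> Poly_Mapping.keys b"
  have "finite S" "Poly_Mapping.keys a \<subseteq> S" "Poly_Mapping.keys b \<subseteq> S" "Poly_Mapping.keys (a + b) \<subseteq> S"
    using Poly_Mapping.keys_add[of a b] by (auto simp: S_def)
  then show ?thesis
    by (simp add: cochain_eval_superset[of S] lookup_add algebra_simps sum.distrib)
qed

lemma cochain_eval_of [simp]: "cochain_eval f (frag_of x) = f x"
  by (simp add: cochain_eval_def)

lemma cochain_eval_cmul: "cochain_eval f (frag_cmul n c) = of_int n * cochain_eval f c"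
  by (subst cochain_eval_superset[of "Poly_Mapping.keys c"])
    (auto simp: keys_cmul cochain_eval_def sum_distrib_left mult.assoc)

lemma cochain_eval_diff: "cochain_eval f (a - b) = cochain_eval f a - cochain_eval f b"
  using cochain_eval_add[of f "a - b" b] by simp

lemma cochain_eval_0 [simp]: "cochain_eval f 0 = 0"
  by (simp add: cochain_eval_def)

lemmas cochain_eval_sum = additive_sum[of "cochain_eval f" for f, OF cochain_eval_add]

text \<open>Pairing \<open>f\<close> with a boundary is pairing the coboundary of \<open>f\<close>
  with a filling chain. The first hypothesis says that this coboundary vanishes on single simplices;
  linearity in the filling does the rest.\<close>

lemma cochain_eval_boundary:
  assumes f: "\<And>\<tau>. singular_simplex (Suc p) X \<tau> \<Longrightarrow> (\<Sum>m\<le>Suc p. (-1) ^ m * f (singular_face (Suc p) m \<tau>)) = 0"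
    and b: "singular_relboundary p X {} b"
  shows "cochain_eval f b = 0"
proof -
  obtain d where d: "singular_chain (Suc p) X d" "chain_boundary (Suc p) d = b"
    using b by (auto simp: singular_boundary)
  have "cochain_eval f (chain_boundary (Suc p) d) = 0"
    using d(1) unfolding singular_chain_def
  proof (induction d rule: frag_induction)
    case (one \<tau>)
    then show ?case
      using f[of \<tau>] by (simp add: chain_boundary_of cochain_eval_sum cochain_eval_cmul del: sum.atMost_Suc)
  next
    case (diff a b)
    then show ?case by (simp add: chain_boundary_diff cochain_eval_diff)
  qed simp
  then show ?thesis using d by simp
qed

section \<open>Cup products of 1-cocycles\<close>

text \<open>Barycentric coordinates are pushed forward along the vertex map \<open>v\<close>, which
  may repeat or reorder vertices, so degenerate and permuted simplices are included.\<close>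

definition subsimplex :: "nat \<Rightarrow> (nat \<Rightarrow> nat) \<Rightarrow> ((nat \<Rightarrow> real) \<Rightarrow> 'a) \<Rightarrow> (nat \<Rightarrow> real) \<Rightarrow> 'a" where
  "subsimplex p v \<sigma> = restrict (\<lambda>t. \<sigma> (\<lambda>i. \<Sum>l\<le>p. if v l = i then t l else 0)) (standard_simplex p)"

lemma subsimplex_in_standard_simplex:
  assumes v: "\<And>l. l \<le> p \<Longrightarrow> v l \<le> q" and t: "t \<in> standard_simplex p"
  shows "(\<lambda>i. \<Sum>l\<le>p. if v l = i then t l else 0) \<in> standard_simplex q"
proof -
  have t0: "\<And>i. 0 \<le> t i" and t1: "(\<Sum>l\<le>p. t l) = 1"
    using t by (auto simp: standard_simplex_def)
  have "(\<Sum>l\<le>p. if v l = i then t l else 0) \<le> (\<Sum>l\<le>p. t l)" for i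
    by (rule sum_mono) (use t0 in auto)
  moreover have "0 \<le> (\<Sum>l\<le>p. if v l = i then t l else 0)" for i
    by (rule sum_nonneg) (use t0 in auto)
  moreover have "(\<Sum>l\<le>p. if v l = i then t l else 0) = 0" if "i > q" for i
    by (rule sum.neutral) (use v that in force)
  moreover have "(\<Sum>i\<le>q. \<Sum>l\<le>p. if v l = i then t l else 0) = (\<Sum>l\<le>p. t l)"
    by (subst sum.swap) (use v in \<open>auto intro!: sum.cong\<close>)
  ultimately show ?thesis
    using t1 by (auto simp: standard_simplex_def)
qed

lemma singular_simplex_subsimplex:
  assumes \<sigma>: "singular_simplex q X \<sigma>" and v: "\<And>l. l \<le> p \<Longrightarrow> v l \<le> q"
  shows "singular_simplex p X (subsimplex p v \<sigma>)"
proof -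
  let ?P = "\<lambda>p. subtopology (powertop_real UNIV) (standard_simplex p)"
  have "continuous_map (?P p) (powertop_real UNIV) (\<lambda>t i. \<Sum>l\<le>p. if v l = i then t l else 0)"
    unfolding continuous_map_componentwise_UNIV
  proof
    fix i
    have "continuous_map (?P p) euclideanreal (\<lambda>t. if v l = i then t l else 0)" for l
      by (auto intro: continuous_map_from_subtopology continuous_map_product_projection)
    then show "continuous_map (?P p) euclideanreal (\<lambda>t. \<Sum>l\<le>p. if v l = i then t l else 0)"
      by (intro continuous_map_sum) auto
  qed
  then have "continuous_map (?P p) (?P q) (\<lambda>t i. \<Sum>l\<le>p. if v l = i then t l else 0)"
    using subsimplex_in_standard_simplex[OF v]
    by (auto simp: continuous_map_in_subtopology)
  then have "continuous_map (?P p) X (\<sigma> \<circ> (\<lambda>t i. \<Sum>l\<le>p. if v l = i then t l else 0))"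
    using \<sigma> by (auto simp: singular_simplex_def intro: continuous_map_compose)
  then show ?thesis
    unfolding singular_simplex_def subsimplex_def
    by (auto simp: o_def continuous_map_in_subtopology intro: continuous_map_eq)
qed

lemma subsimplex_cong: "(\<And>l. l \<le> p \<Longrightarrow> v l = w l) \<Longrightarrow> subsimplex p v \<sigma> = subsimplex p w \<sigma>"
  unfolding subsimplex_def by (intro restrict_ext arg_cong[of _ _ \<sigma>] ext sum.cong) auto

lemma simplical_face_alt:
  "simplical_face m x = (\<lambda>i. if i = m then 0 else x (if i < m then i else i - 1))"
  by (auto simp: simplical_face_def fun_eq_iff)

text \<open>A subsimplex of a face is a subsimplex of the whole: compose the vertex map with the
  injection that skips \<open>m\<close>.\<close>

lemma subsimplex_singular_face:
  assumes v: "\<And>l. l \<le> p \<Longrightarrow> v l \<le> q" 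
  shows "subsimplex p v (singular_face (Suc q) m \<sigma>) = subsimplex p (\<lambda>l. if v l < m then v l else Suc (v l)) \<sigma>"
proof -
  have "simplical_face m (\<lambda>i. \<Sum>l\<le>p. if v l = i then t l else 0)
      = (\<lambda>i. \<Sum>l\<le>p. if (if v l < m then v l else Suc (v l)) = i then t l else 0)" for t :: "nat \<Rightarrow> real"
  proof
    fix i
    show "simplical_face m (\<lambda>i. \<Sum>l\<le>p. if v l = i then t l else 0) i
      = (\<Sum>l\<le>p. if (if v l < m then v l else Suc (v l)) = i then t l else 0)"
    proof (cases "i = m")
      case True
      then have "(if v l < m then v l else Suc (v l)) \<noteq> i" for l
        by auto
      with True show ?thesis
        by (simp add: simplical_face_def)
    next
      case False
      then show ?thesis
        unfolding simplical_face_alt by (auto intro!: sum.cong)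
    qed
  qed
  then show ?thesis
    unfolding subsimplex_def singular_face_def
    by (intro restrict_ext) (simp add: subsimplex_in_standard_simplex[OF v])
qed

text \<open>Dually, a face of a subsimplex precomposes the vertex map with the injection that skips
  \<open>m\<close>, since the coordinate \<open>m\<close> vanishes on that face.\<close>

lemma singular_face_subsimplex:
  assumes "p > 0" "m \<le> p"
  shows "singular_face p m (subsimplex p v \<sigma>) = subsimplex (p - 1) (\<lambda>l. if l < m then v l else v (Suc l)) \<sigma>"
proof -
  have "(\<Sum>l\<le>p. if v l = i then simplical_face m t l else 0)
      = (\<Sum>l\<le>p - 1. if (if l < m then v l else v (Suc l)) = i then t l else 0)" for t :: "nat \<Rightarrow> real" and i
  proof -
    have "(\<Sum>l\<le>p. if v l = i then simplical_face m t l else 0)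
      = (\<Sum>l\<in>{..p} - {m}. if v l = i then simplical_face m t l else 0)"
      by (rule sum.mono_neutral_right) (auto simp: simplical_face_def)
    also have "\<dots> = (\<Sum>l\<le>p - 1. if (if l < m then v l else v (Suc l)) = i then t l else 0)"
      by (rule sum.reindex_bij_witness[of _ "\<lambda>l. if l < m then l else Suc l" "\<lambda>l. if l < m then l else l - 1"])
        (use assms in \<open>auto simp: simplical_face_def\<close>)
    finally show ?thesis .
  qed
  then show ?thesis
    using assms simplical_face_in_standard_simplex[of p m]
    unfolding subsimplex_def singular_face_def One_nat_def by (intro restrict_ext) simp
qed

definition edge :: "nat \<Rightarrow> nat \<Rightarrow> ((nat \<Rightarrow> real) \<Rightarrow> 'a) \<Rightarrow> (nat \<Rightarrow> real) \<Rightarrow> 'a" where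
  "edge a b \<sigma> = subsimplex 1 (\<lambda>l. if l = 0 then a else b) \<sigma>"

lemma edge_singular_face:
  assumes "a \<le> q" "b \<le> q"
  shows "edge a b (singular_face (Suc q) m \<sigma>)
    = edge (if a < m then a else Suc a) (if b < m then b else Suc b) \<sigma>"
  unfolding edge_def
  by (subst subsimplex_singular_face) (use assms in \<open>auto intro: subsimplex_cong\<close>)

text \<open>Vanishing of the coboundary, solved for the long edge: its value is the sum of the
  values on the two short edges.\<close>

definition cocycle1 :: "'a topology \<Rightarrow> (((nat \<Rightarrow> real) \<Rightarrow> 'a) \<Rightarrow> 'b::comm_ring_1) \<Rightarrow> bool" where
  "cocycle1 X f \<longleftrightarrow> (\<forall>\<tau>. singular_simplex 2 X \<tau> \<longrightarrow>
     f (singular_face 2 1 \<tau>) = f (singular_face 2 2 \<tau>) + f (singular_face 2 0 \<tau>))"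

text \<open>The cocycle condition is applied to the 2-simplex with vertices \<open>a\<close>,
  \<open>b\<close>, \<open>c\<close> of \<open>\<sigma>\<close>; it may be degenerate, so no order
  of the vertices is assumed.\<close>

lemma cocycle1_edge:
  assumes f: "cocycle1 X f" and \<sigma>: "singular_simplex q X \<sigma>" and "a \<le> q" "b \<le> q" "c \<le> q"
  shows "f (edge a c \<sigma>) = f (edge a b \<sigma>) + f (edge b c \<sigma>)"
proof -
  define v where "v = (\<lambda>l::nat. if l = 0 then a else if l = 1 then b else c)"
  define \<tau> where "\<tau> = subsimplex 2 v \<sigma>"
  have "singular_simplex 2 X \<tau>"
    unfolding \<tau>_def by (rule singular_simplex_subsimplex[OF \<sigma>]) (use assms in \<open>auto simp: v_def\<close>)
  moreover have "singular_face 2 1 \<tau> = edge a c \<sigma>" "singular_face 2 2 \<tau> = edge a b \<sigma>"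
    "singular_face 2 0 \<tau> = edge b c \<sigma>"
    unfolding \<tau>_def edge_def
    by (auto simp: singular_face_subsimplex v_def intro!: subsimplex_cong)
  ultimately show ?thesis
    using f by (auto simp: cocycle1_def)
qed

text \<open>The iterated Alexander-Whitney cup product of 1-cochains: the factor \<open>l\<close>
  sees the edge from vertex \<open>l\<close> to its successor.\<close>

definition cup1 :: "nat \<Rightarrow> (nat \<Rightarrow> ((nat \<Rightarrow> real) \<Rightarrow> 'a) \<Rightarrow> 'b::comm_ring_1) \<Rightarrow> ((nat \<Rightarrow> real) \<Rightarrow> 'a) \<Rightarrow> 'b" where
  "cup1 p f \<sigma> = (\<Prod>l<p. f l (edge l (Suc l) \<sigma>))"

text \<open>Each \<open>P m\<close> with \<open>m \<le> p\<close> occurs in the summands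
  \<open>m\<close> and \<open>m + 1\<close>, hence with opposite signs.\<close>

lemma alternating_telescope:
  fixes P :: "nat \<Rightarrow> 'b::comm_ring_1"
  shows "(\<Sum>m\<le>Suc p. (-1) ^ m * (if m = 0 then P 0 else if m = Suc p then P p else P m + P (m - 1))) = 0"
proof -
  have "(\<Sum>m\<le>q. (-1) ^ m * (if m = 0 then P 0 else P m + P (m - 1))) = (-1) ^ q * P q" for q
    by (induction q) (auto simp: algebra_simps)
  from this[of p] show ?thesis
    by (simp cong: if_cong)
qed

text \<open>Every face of \<open>\<tau>\<close> contributes one or two of the products \<open>P m\<close> below, and these telescope.\<close>

lemma cup1_cocycle:
  assumes f: "\<And>l. l < p \<Longrightarrow> cocycle1 X (f l)" and \<tau>: "singular_simplex (Suc p) X \<tau>"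
  shows "(\<Sum>m\<le>Suc p. (-1) ^ m * cup1 p f (singular_face (Suc p) m \<tau>)) = 0"
proof -
  define g where "g \<equiv> \<lambda>l. f l (edge l (Suc l) \<tau>)"
  define h where "h \<equiv> \<lambda>l. f l (edge (Suc l) (Suc (Suc l)) \<tau>)"
  \<comment> \<open>The product along the path of consecutive edges of \<open>\<tau>\<close> in
    which the edge from vertex \<open>m\<close> to vertex \<open>m + 1\<close> is left out.\<close>
  define P where "P \<equiv> \<lambda>m. (\<Prod>l<p. if l < m then g l else h l)"
  \<comment> \<open>Deleting vertex \<open>m\<close> merges its two adjacent edges into one, on
    which the cocycle is the sum \<open>g l + h l\<close> with \<open>l = m - 1\<close>; earlier
    edges keep their place and later ones are shifted.\<close>
  have face: "cup1 p f (singular_face (Suc p) m \<tau>)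
      = (\<Prod>l<p. if Suc l < m then g l else if Suc l = m then g l + h l else h l)" for m
    unfolding cup1_def
  proof (rule prod.cong)
    fix l assume "l \<in> {..<p}"
    then show "f l (edge l (Suc l) (singular_face (Suc p) m \<tau>))
       = (if Suc l < m then g l else if Suc l = m then g l + h l else h l)"
      using cocycle1_edge[OF f \<tau>, of l l "Suc l" "Suc (Suc l)"]
      by (auto simp: edge_singular_face g_def h_def)
  qed simp
  have "cup1 p f (singular_face (Suc p) m \<tau>) = P m + P (m - 1)" if m: "0 < m" "m \<le> p" for m
  proof -
    obtain n where n: "m = Suc n" "n < p" using m by (cases m) auto
    \<comment> \<open>Singles out the factor \<open>n = m - 1\<close>, the only one in which
      \<open>P m\<close>, \<open>P (m - 1)\<close> and the product of the face differ.\<close>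
    have split: "(\<Prod>l<p. r l) = r n * (\<Prod>l\<in>{..<p} - {n}. r l)" for r :: "nat \<Rightarrow> 'b"
      using n by (subst prod.remove[of _ n]) auto
    have "(\<Prod>l\<in>{..<p} - {n}. if Suc l < m then g l else if Suc l = m then g l + h l else h l)
      = (\<Prod>l\<in>{..<p} - {n}. if l < m then g l else h l)"
      "(\<Prod>l\<in>{..<p} - {n}. if l < m - 1 then g l else h l) = (\<Prod>l\<in>{..<p} - {n}. if l < m then g l else h l)"
      by (intro prod.cong refl; use n in auto)+
    then show ?thesis
      unfolding face P_def by (simp only: split) (simp add: n algebra_simps)
  qed
  moreover have "cup1 p f (singular_face (Suc p) 0 \<tau>) = P 0"
    unfolding face P_def by simp
  moreover have "cup1 p f (singular_face (Suc p) (Suc p) \<tau>) = P p"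
    unfolding face P_def by (rule prod.cong) auto
  ultimately have "cup1 p f (singular_face (Suc p) m \<tau>)
      = (if m = 0 then P 0 else if m = Suc p then P p else P m + P (m - 1))" if "m \<le> Suc p" for m
    using that by auto
  then have "(\<Sum>m\<le>Suc p. (-1) ^ m * cup1 p f (singular_face (Suc p) m \<tau>))
      = (\<Sum>m\<le>Suc p. (-1) ^ m * (if m = 0 then P 0 else if m = Suc p then P p else P m + P (m - 1)))"
    by (intro sum.cong) auto
  then show ?thesis
    by (simp only: alternating_telescope)
qed

section \<open>Winding cocycles on the torus\<close>

text \<open>The total change of a continuous logarithm along a path; for a closed path, 2 pi i times
  its winding number about 0.\<close>

definition has_log_change :: "(real \<Rightarrow> complex) \<Rightarrow> complex \<Rightarrow> bool" where
  "has_log_change p d \<longleftrightarrow>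
     (\<exists>g. continuous_on {0..1} g \<and> (\<forall>s\<in>{0..1}. p s = exp (g s)) \<and> d = g 1 - g 0)"

text \<open>Two continuous logarithms differ by a continuous function with values in the discrete
  set of multiples of 2 pi i, so by a constant on the connected interval.\<close>

lemma has_log_change_unique:
  assumes "has_log_change p d" "has_log_change p d'"
  shows "d = d'"
proof -
  obtain g h where g: "continuous_on {0..1} g" "\<And>s. s \<in> {0..1} \<Longrightarrow> p s = exp (g s)" "d = g 1 - g 0"
    and h: "continuous_on {0..1} h" "\<And>s. s \<in> {0..1} \<Longrightarrow> p s = exp (h s)" "d' = h 1 - h 0"
    using assms unfolding has_log_change_def by metis
  have "(\<lambda>s. g s - h s) constant_on {0..1}"
  proof (rule continuous_discrete_range_constant)
    show "connected {0..1::real}" by simp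
    show "continuous_on {0..1} (\<lambda>s. g s - h s)"
      using g h by (intro continuous_intros) auto
    fix s :: real assume s: "s \<in> {0..1}"
    show "\<exists>e>0. \<forall>t. t \<in> {0..1} \<and> g t - h t \<noteq> g s - h s \<longrightarrow> e \<le> norm (g t - h t - (g s - h s))"
    proof (intro exI[of _ "2 * pi"] conjI allI impI)
      fix t assume t: "t \<in> {0..1} \<and> g t - h t \<noteq> g s - h s"
      have "exp (g t - h t) = 1" "exp (g s - h s) = 1"
        using g(2) h(2) s t by (metis div_self exp_diff exp_not_eq_zero)+
      then have "exp (g t - h t - (g s - h s)) = 1"
        by (simp add: exp_diff)
      then obtain n :: int where n: "Re (g t - h t - (g s - h s)) = 0"
          "Im (g t - h t - (g s - h s)) = of_int (2 * n) * pi"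
        by (auto simp: exp_eq_1)
      have "n \<noteq> 0"
        using n t by (auto simp: complex_eq_iff)
      then have "1 \<le> \<bar>real_of_int n\<bar>"
        by linarith
      then have "2 * pi \<le> \<bar>Im (g t - h t - (g s - h s))\<bar>"
        using n(2) by (simp add: abs_mult)
      also have "\<dots> \<le> norm (g t - h t - (g s - h s))"
        by (rule abs_Im_le_cmod)
      finally show "2 * pi \<le> norm (g t - h t - (g s - h s))" .
    qed simp
  qed
  then have "g 1 - h 1 = g 0 - h 0"
    by (auto simp: constant_on_def)
  then have "g 1 - g 0 = h 1 - h 0"
    by (simp add: algebra_simps)
  then show ?thesis
    using g(3) h(3) by simp
qed

definition segment_point :: "real \<Rightarrow> nat \<Rightarrow> real" where
  "segment_point s = (\<lambda>i. if i = 0 then 1 - s else if i = 1 then s else 0)"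

definition triangle_point :: "real \<times> real \<Rightarrow> nat \<Rightarrow> real" where
  "triangle_point = (\<lambda>(s, t) i. if i = 0 then 1 - s - t else if i = 1 then s else if i = 2 then t else 0)"

lemma segment_point_in_standard_simplex: "s \<in> {0..1} \<Longrightarrow> segment_point s \<in> standard_simplex 1"
  by (auto simp: segment_point_def standard_simplex_def)

lemma triangle_point_in_standard_simplex:
  "\<lbrakk>0 \<le> s; 0 \<le> t; s + t \<le> 1\<rbrakk> \<Longrightarrow> triangle_point (s, t) \<in> standard_simplex 2"
  by (auto simp: triangle_point_def standard_simplex_def eval_nat_numeral)

definition log_change :: "nat \<Rightarrow> ((nat \<Rightarrow> real) \<Rightarrow> nat \<Rightarrow> complex) \<Rightarrow> complex" where
  "log_change i \<sigma> = (THE d. has_log_change (\<lambda>s. \<sigma> (segment_point s) i) d)"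

lemma log_change_eq: "has_log_change (\<lambda>s. \<sigma> (segment_point s) i) d \<Longrightarrow> log_change i \<sigma> = d"
  unfolding log_change_def using has_log_change_unique by blast

lemma continuous_map_torus_coordinate: "continuous_map (torus k) euclidean (\<lambda>z. z i)"
  unfolding torus_def
  by (intro continuous_map_from_subtopology continuous_map_product_projection) auto

lemma torus_nonzero: "z \<in> topspace (torus k) \<Longrightarrow> z i \<noteq> 0"
  by (cases "i < k") (auto simp: torus_def torus_set_def)

text \<open>A torus coordinate of a 2-simplex is a nonvanishing function on a contractible triangle,
  so it has a continuous logarithm \<open>G\<close> there; its changes along the three edges add
  up.\<close>

lemma cocycle1_log_change: "cocycle1 (torus k) (log_change i)"
  unfolding cocycle1_def
proof (intro allI impI)
  fix \<tau> assume \<tau>: "singular_simplex 2 (torus k) \<tau>"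
  define D where "D = {p::real \<times> real. 0 \<le> fst p \<and> 0 \<le> snd p \<and> fst p + snd p \<le> 1}"
  define F where "F \<equiv> \<lambda>p. \<tau> (triangle_point p) i"
  let ?P = "subtopology (powertop_real UNIV) (standard_simplex 2)"
  have tri: "triangle_point p \<in> standard_simplex 2" if "p \<in> D" for p
    using that triangle_point_in_standard_simplex[of "fst p" "snd p"] by (simp add: D_def)
  have "continuous_map (top_of_set D) (powertop_real UNIV) triangle_point"
    unfolding continuous_map_componentwise_UNIV
  proof
    fix j :: nat
    show "continuous_map (top_of_set D) euclideanreal (\<lambda>p. triangle_point p j)"
      unfolding triangle_point_def case_prod_unfold
      by (cases "j = 0"; cases "j = 1"; cases "j = 2") (auto intro!: continuous_intros)
  qed
  then have "continuous_map (top_of_set D) ?P triangle_point"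
    using tri by (auto simp: continuous_map_in_subtopology)
  moreover have "continuous_map ?P (torus k) \<tau>"
    using \<tau> by (simp add: singular_simplex_def)
  ultimately have "continuous_map (top_of_set D) (torus k) (\<tau> \<circ> triangle_point)"
    by (rule continuous_map_compose)
  then have "continuous_map (top_of_set D) euclidean ((\<lambda>z. z i) \<circ> (\<tau> \<circ> triangle_point))"
    by (rule continuous_map_compose) (rule continuous_map_torus_coordinate)
  then have contF: "continuous_on D F"
    by (simp add: F_def o_def)
  have "F p \<noteq> 0" if "p \<in> D" for p
  proof -
    have "\<tau> (triangle_point p) \<in> topspace (torus k)"
      using \<tau> tri[OF that] by (force simp: singular_simplex_def continuous_map_def)
    then show ?thesis
      unfolding F_def by (rule torus_nonzero)
  qed
  moreover have "convex D"
  proof -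
    have "D = {p. 0 \<le> fst p} \<inter> {p. 0 \<le> snd p} \<inter> {p. (1,1) \<bullet> p \<le> 1}"
      by (auto simp: D_def inner_prod_def)
    moreover have "convex {p::real\<times>real. 0 \<le> fst p}" "convex {p::real\<times>real. 0 \<le> snd p}"
      by (auto simp: convex_def)
    ultimately show ?thesis
      by (simp add: convex_Int convex_halfspace_le)
  qed
  then have "contractible D"
    by (rule convex_imp_contractible)
  ultimately obtain G where G: "continuous_on D G" "\<And>p. p \<in> D \<Longrightarrow> F p = exp (G p)"
    using continuous_logarithm_on_contractible[OF contF] by metis
  \<comment> \<open>\<open>\<gamma>\<close> traces the face \<open>m\<close> inside the planar
    triangle \<open>D\<close>, and \<open>G\<close> along \<open>\<gamma>\<close> is a logarithm on
    that face. Each of the three faces then only needs its \<open>\<gamma>\<close>.\<close>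
  have edge: "log_change i (singular_face 2 m \<tau>) = G (\<gamma> 1) - G (\<gamma> 0)"
    if "m \<le> 2" "continuous_on {0..1} \<gamma>" "\<And>s. s \<in> {0..1} \<Longrightarrow> \<gamma> s \<in> D"
      "\<And>s. simplical_face m (segment_point s) = triangle_point (\<gamma> s)" for m and \<gamma> :: "real \<Rightarrow> real \<times> real"
  proof (rule log_change_eq, unfold has_log_change_def, intro exI conjI ballI)
    show "continuous_on {0..1} (\<lambda>s. G (\<gamma> s))"
      by (rule continuous_on_compose2[OF G(1) that(2)]) (use that(3) in blast)
    fix s :: real assume "s \<in> {0..1}"
    then show "singular_face 2 m \<tau> (segment_point s) i = exp (G (\<gamma> s))"
      using that G(2)[of "\<gamma> s"] segment_point_in_standard_simplex[of s]
      by (auto simp: singular_face_def F_def)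
  qed simp
  have "log_change i (singular_face 2 1 \<tau>) = G (0, 1) - G (0, 0)"
    by (subst edge[where \<gamma> = "\<lambda>s. (0, s)"])
      (auto simp: D_def simplical_face_def segment_point_def triangle_point_def fun_eq_iff
        intro!: continuous_intros)
  moreover have "log_change i (singular_face 2 2 \<tau>) = G (1, 0) - G (0, 0)"
    by (subst edge[where \<gamma> = "\<lambda>s. (s, 0)"])
      (auto simp: D_def simplical_face_def segment_point_def triangle_point_def fun_eq_iff
        intro!: continuous_intros)
  moreover have "log_change i (singular_face 2 0 \<tau>) = G (0, 1) - G (1, 0)"
    by (subst edge[where \<gamma> = "\<lambda>s. (1 - s, s)"])
      (auto simp: D_def simplical_face_def segment_point_def triangle_point_def fun_eq_iff
        intro!: continuous_intros)
  ultimately show "log_change i (singular_face 2 1 \<tau>)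
      = log_change i (singular_face 2 2 \<tau>) + log_change i (singular_face 2 0 \<tau>)"
    by simp
qed

lemma cocycle1_boundary:
  assumes "cocycle1 X f" "singular_relboundary 1 X {} b"
  shows "cochain_eval f b = 0"
proof (rule cochain_eval_boundary[OF _ assms(2)])
  fix \<tau> assume "singular_simplex (Suc 1) X \<tau>"
  then show "(\<Sum>m\<le>Suc 1. (-1) ^ m * f (singular_face (Suc 1) m \<tau>)) = 0"
    using assms(1) by (simp add: cocycle1_def numeral_2_eq_2)
qed

section \<open>The exponential covering of the torus and its coordinate loops\<close>

definition torus_exp :: "(nat \<Rightarrow> real) \<Rightarrow> nat \<Rightarrow> complex" where
  "torus_exp v = (\<lambda>i. cis (2 * pi * v i))"

definition unit_vector :: "nat \<Rightarrow> nat \<Rightarrow> real" where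
  "unit_vector i = (\<lambda>m. if m = i then 1 else 0)"

text \<open>The straight path from the origin to \<open>v\<close>, encoded as an affine simplex so
  that its faces and edges can be computed from its vertices.\<close>

definition linear_path :: "(nat \<Rightarrow> real) \<Rightarrow> (nat \<Rightarrow> real) \<Rightarrow> nat \<Rightarrow> real" where
  "linear_path v = oriented_simplex 1 (\<lambda>l. if l = 0 then (\<lambda>_. 0) else v)"

lemma torus_exp_add: "torus_exp (\<lambda>i. u i + v i) = torus_mult (torus_exp u) (torus_exp v)"
  by (simp add: torus_exp_def torus_mult_def fun_eq_iff cis_mult algebra_simps)

lemma torus_exp_int: "(\<And>i. z i \<in> \<int>) \<Longrightarrow> torus_exp z = torus_one"
  by (simp add: torus_exp_def torus_one_def fun_eq_iff cis_multiple_2pi)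

lemma torus_exp_in_torus_set: "v \<in> topspace (Euclidean_space k) \<Longrightarrow> torus_exp v \<in> torus_set k"
  by (auto simp: torus_exp_def torus_set_def topspace_Euclidean_space)

lemma continuous_map_torus_exp: "continuous_map (Euclidean_space k) (torus k) torus_exp"
proof -
  have "continuous_map (Euclidean_space k) euclidean (\<lambda>v. cis (2 * pi * v i))" for i
  proof -
    have "continuous_map (Euclidean_space k) euclideanreal (\<lambda>v. v i)"
      unfolding Euclidean_space_def
      by (intro continuous_map_from_subtopology continuous_map_product_projection) auto
    moreover have "continuous_map euclideanreal euclidean (\<lambda>x. cis (2 * pi * x))"
      by (auto intro!: continuous_intros simp: cis_conv_exp)
    ultimately have "continuous_map (Euclidean_space k) euclidean ((\<lambda>x. cis (2 * pi * x)) \<circ> (\<lambda>v. v i))"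
      by (rule continuous_map_compose)
    then show ?thesis by (simp add: o_def)
  qed
  then have "continuous_map (Euclidean_space k) (product_topology (\<lambda>i. euclidean) UNIV) torus_exp"
    unfolding continuous_map_componentwise_UNIV by (simp add: torus_exp_def)
  then show ?thesis
    unfolding torus_def continuous_map_in_subtopology using torus_exp_in_torus_set by blast
qed

lemma singular_simplex_oriented_simplex:
  assumes "\<And>l. l \<le> p \<Longrightarrow> w l \<in> topspace (Euclidean_space k)"
  shows "singular_simplex p (Euclidean_space k) (oriented_simplex p w)"
  unfolding Euclidean_space_def
  by (rule simplicial_imp_singular_simplex)
    (use assms in \<open>auto simp: simplicial_simplex_oriented_simplex topspace_Euclidean_space\<close>)

lemma singular_simplex_linear_path:
  "v \<in> topspace (Euclidean_space k) \<Longrightarrow> singular_simplex 1 (Euclidean_space k) (linear_path v)"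
  unfolding linear_path_def
  by (rule singular_simplex_oriented_simplex) (auto simp: topspace_Euclidean_space)

lemma linear_path_segment_point:
  "s \<in> {0..1} \<Longrightarrow> linear_path v (segment_point s) = (\<lambda>i. s * v i)"
  using segment_point_in_standard_simplex[of s]
  by (auto simp: linear_path_def oriented_simplex_def segment_point_def)

lemma log_change_torus_loop:
  "log_change i (simplex_map 1 torus_exp (linear_path (unit_vector m)))
   = (if i = m then 2 * pi * \<i> else 0)"
proof (rule log_change_eq, unfold has_log_change_def, intro exI conjI ballI)
  let ?g = "\<lambda>s. of_real s * (if i = m then 2 * pi * \<i> else 0)"
  show "continuous_on {0..1} ?g" by (intro continuous_intros)
  show "(if i = m then 2 * pi * \<i> else 0) = ?g 1 - ?g 0" by simp
  fix s :: real assume "s \<in> {0..1}"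
  then show "simplex_map 1 torus_exp (linear_path (unit_vector m)) (segment_point s) i = exp (?g s)"
    using segment_point_in_standard_simplex[of s] linear_path_segment_point[of s]
    by (simp add: simplex_map_def torus_exp_def unit_vector_def cis_conv_exp mult_ac)
qed

text \<open>The winding cocycle of coordinate \<open>i\<close> vanishes on boundaries and on every
  loop but the one numbered \<open>i\<close>, so evaluating it on the combination leaves 2 pi i
  times \<open>a i\<close>.\<close>

lemma torus_loops_independent:
  assumes "singular_relboundary 1 (torus k) {}
      (\<Sum>m<k. frag_cmul (a m) (frag_of (simplex_map 1 torus_exp (linear_path (unit_vector m)))))"
    and "i < k"
  shows "a i = 0"
proof -
  have "0 = cochain_eval (log_change i)
      (\<Sum>m<k. frag_cmul (a m) (frag_of (simplex_map 1 torus_exp (linear_path (unit_vector m)))))"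
    using cocycle1_boundary[OF cocycle1_log_change assms(1)] by simp
  also have "\<dots> = (\<Sum>m<k. if i = m then of_int (a m) * (2 * pi * \<i>) else 0)"
    unfolding cochain_eval_sum
    by (rule sum.cong) (auto simp: cochain_eval_cmul log_change_torus_loop simp del: One_nat_def)
  also have "\<dots> = of_int (a i) * (2 * pi * \<i>)"
    using assms(2) by simp
  finally show ?thesis by simp
qed

section \<open>Orbit simplices and dual cocycles\<close>

text \<open>Reindexing an alternating sum by composition with \<open>q\<close> costs the sign of
  \<open>q\<close>. In the boundary of the cube, \<open>q\<close> is a transposition for inner faces
  and a cyclic shift for outer ones.\<close>

lemma sign_permutations_shift:
  assumes q: "q permutes {..<n::nat}"
    and fg: "\<And>\<pi>. \<pi> permutes {..<n} \<Longrightarrow> f \<pi> = g (\<pi> \<circ> q)"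
  shows "(\<Sum>\<pi> | \<pi> permutes {..<n}. frag_cmul (sign \<pi>) (f \<pi>))
       = frag_cmul (sign q) (\<Sum>\<pi> | \<pi> permutes {..<n}. frag_cmul (sign \<pi>) (g \<pi>))"
proof -
  have "frag_cmul (sign q) (\<Sum>\<pi> | \<pi> permutes {..<n}. frag_cmul (sign \<pi>) (g \<pi>))
      = (\<Sum>\<pi> | \<pi> permutes {..<n}. frag_cmul (sign q * sign (\<pi> \<circ> q)) (g (\<pi> \<circ> q)))"
    by (subst sum_permutations_compose_right[OF q]) (simp add: frag_cmul_sum)
  also have "\<dots> = (\<Sum>\<pi> | \<pi> permutes {..<n}. frag_cmul (sign \<pi>) (f \<pi>))"
  proof (rule sum.cong)
    fix \<pi> assume "\<pi> \<in> {\<pi>. \<pi> permutes {..<n}}"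
    then have \<pi>: "\<pi> permutes {..<n}" by simp
    have "permutation \<pi>" "permutation q"
      using \<pi> q permutation_permutes by blast+
    then show "frag_cmul (sign q * sign (\<pi> \<circ> q)) (g (\<pi> \<circ> q)) = frag_cmul (sign \<pi>) (f \<pi>)"
      using fg[OF \<pi>] by (simp add: sign_compose mult.left_commute[of "sign q"])
  qed simp
  finally show ?thesis by simp
qed

definition cyclic_shift :: "nat \<Rightarrow> nat \<Rightarrow> nat" where
  "cyclic_shift n x = (if x < n then Suc x else if x = n then 0 else x)"

text \<open>By induction: following the shift by the transposition of \<open>0\<close> and
  \<open>Suc n\<close> lengthens the cycle by one and flips the sign.\<close>

lemma cyclic_shift: "cyclic_shift n permutes {..<Suc n} \<and> sign (cyclic_shift n) = (-1) ^ n"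
proof (induction n)
  case 0
  have "cyclic_shift 0 = id" by (auto simp: cyclic_shift_def)
  then show ?case by (simp only: permutes_id) simp
next
  case (Suc n)
  have eq: "cyclic_shift (Suc n) = Transposition.transpose 0 (Suc n) \<circ> cyclic_shift n"
    by (auto simp: cyclic_shift_def fun_eq_iff Transposition.transpose_def)
  have c: "cyclic_shift n permutes {..<Suc (Suc n)}"
    by (rule permutes_subset[OF conjunct1[OF Suc.IH]]) auto
  have t: "Transposition.transpose 0 (Suc n) permutes {..<Suc (Suc n)}"
    by (rule permutes_swap_id) auto
  have "permutation (cyclic_shift n)"
    using c permutation_permutes by blast
  then have "sign (cyclic_shift (Suc n)) = sign (Transposition.transpose 0 (Suc n)) * sign (cyclic_shift n)"
    unfolding eq by (rule sign_compose[OF permutation_swap_id])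
  moreover have "cyclic_shift (Suc n) permutes {..<Suc (Suc n)}"
    unfolding eq by (rule permutes_compose[OF c t])
  ultimately show ?case
    using Suc.IH by (simp add: sign_swap_id)
qed

text \<open>Integral chains have no 2-torsion.\<close>

lemma frag_eq_uminus_imp_0: "c = - c \<Longrightarrow> c = (0 :: 'a \<Rightarrow>\<^sub>0 int)"
proof -
  assume c: "c = - c"
  have "poly_mapping.lookup c x = - poly_mapping.lookup c x" for x
    using arg_cong[OF c, of "\<lambda>c. poly_mapping.lookup c x"] by simp
  then have "poly_mapping.lookup c x = 0" for x
    by (metis equal_neg_zero)
  then show "c = 0"
    by (simp add: poly_mapping_eq_iff fun_eq_iff)
qed

text \<open>An affine simplex is determined by its vertices, so selecting vertices through
  \<open>v\<close> means composing \<open>w\<close> with \<open>v\<close>.\<close>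

lemma subsimplex_simplex_map_oriented_simplex:
  assumes v: "\<And>l. l \<le> p \<Longrightarrow> v l \<le> q"
  shows "subsimplex p v (simplex_map q f (oriented_simplex q w))
       = simplex_map p f (oriented_simplex p (\<lambda>l. w (v l)))"
proof -
  have "(\<Sum>j\<le>q. w j i * (\<Sum>l\<le>p. if v l = j then t l else 0)) = (\<Sum>l\<le>p. w (v l) i * t l)" for t i
  proof -
    have "(\<Sum>j\<le>q. w j i * (\<Sum>l\<le>p. if v l = j then t l else 0))
        = (\<Sum>j\<le>q. \<Sum>l\<le>p. if v l = j then w j i * t l else 0)"
      by (simp add: sum_distrib_left if_distrib cong: if_cong)
    also have "\<dots> = (\<Sum>l\<le>p. w (v l) i * t l)"
      by (subst sum.swap) (use v in \<open>auto intro!: sum.cong\<close>)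
    finally show ?thesis .
  qed
  then show ?thesis
    unfolding subsimplex_def simplex_map_def oriented_simplex_def
    by (intro restrict_ext) (simp add: subsimplex_in_standard_simplex[OF v])
qed

lemma singular_face_simplex_map_oriented_simplex:
  assumes "1 \<le> p" "m \<le> p"
  shows "singular_face p m (simplex_map p f (oriented_simplex p w))
       = simplex_map (p - 1) f (oriented_simplex (p - 1) (\<lambda>j. if j < m then w j else w (Suc j)))"
proof -
  have "singular_face p m (simplex_map p f (oriented_simplex p w))
      = simplex_map (p - 1) f (singular_face p m (oriented_simplex p w))"
    using assms simplical_face_in_standard_simplex[of p m]
    by (auto simp: singular_face_def simplex_map_def fun_eq_iff restrict_def)
  then show ?thesis
    using assms by (simp add: singular_face_oriented_simplex)
qed

section \<open>Images of affine simplices in the orbit of a base point\<close>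

locale torus_orbit =
  fixes k :: nat and X :: "'a topology" and act :: "(nat \<Rightarrow> complex) \<Rightarrow> 'a \<Rightarrow> 'a" and x0 :: 'a
  assumes action: "torus_action k X act" and x0: "x0 \<in> topspace X"
begin

definition orbit_exp :: "(nat \<Rightarrow> real) \<Rightarrow> 'a" where
  "orbit_exp v = act (torus_exp v) x0"

definition orbit_simplex :: "nat \<Rightarrow> (nat \<Rightarrow> nat \<Rightarrow> real) \<Rightarrow> (nat \<Rightarrow> real) \<Rightarrow> 'a" where
  "orbit_simplex p w = simplex_map p orbit_exp (oriented_simplex p w)"

definition orbit_path :: "(nat \<Rightarrow> real) \<Rightarrow> (nat \<Rightarrow> real) \<Rightarrow> 'a" where
  "orbit_path v = simplex_map 1 orbit_exp (linear_path v)"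

lemma orbit_path_eq: "orbit_path v = orbit_simplex 1 (\<lambda>l. if l = 0 then (\<lambda>_. 0) else v)"
  by (simp add: orbit_path_def orbit_simplex_def linear_path_def)

lemma continuous_map_orbit: "continuous_map (torus k) X (\<lambda>t. act t x0)"
proof -
  have "continuous_map (torus k) (prod_topology (torus k) X) (\<lambda>t. (t, x0))"
    using x0 by (auto simp: continuous_map_pairwise o_def)
  then have "continuous_map (torus k) X ((\<lambda>(t, x). act t x) \<circ> (\<lambda>t. (t, x0)))"
    using action by (auto simp: torus_action_def intro: continuous_map_compose)
  then show ?thesis by (simp add: o_def)
qed

lemma continuous_map_orbit_exp: "continuous_map (Euclidean_space k) X orbit_exp"
  using continuous_map_compose[OF continuous_map_torus_exp continuous_map_orbit]
  by (simp add: o_def orbit_exp_def[abs_def])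

lemma orbit_exp_add:
  assumes "u \<in> topspace (Euclidean_space k)" "v \<in> topspace (Euclidean_space k)"
  shows "orbit_exp (\<lambda>i. u i + v i) = act (torus_exp u) (orbit_exp v)"
  using assms action x0 torus_exp_in_torus_set
  by (simp add: orbit_exp_def torus_exp_add torus_action_def)

lemma orbit_exp_int:
  assumes "\<And>i. z i \<in> \<int>"
  shows "orbit_exp z = x0"
  using action x0 by (simp add: orbit_exp_def torus_exp_int[OF assms] torus_action_def)

lemma orbit_exp_stabilizer:
  assumes "u \<in> topspace (Euclidean_space k)" "v \<in> topspace (Euclidean_space k)" "orbit_exp v = x0"
  shows "orbit_exp (\<lambda>i. u i + v i) = orbit_exp u"
  using orbit_exp_add[OF assms(1,2)] assms(3) by (simp add: orbit_exp_def)

lemma singular_simplex_orbit_simplex: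
  assumes "\<And>l. l \<le> p \<Longrightarrow> w l \<in> topspace (Euclidean_space k)"
  shows "singular_simplex p X (orbit_simplex p w)"
  unfolding orbit_simplex_def
  by (rule singular_simplex_simplex_map[OF singular_simplex_oriented_simplex continuous_map_orbit_exp])
    (use assms in auto)

lemma singular_simplex_orbit_path:
  "v \<in> topspace (Euclidean_space k) \<Longrightarrow> singular_simplex 1 X (orbit_path v)"
  unfolding orbit_path_eq
  by (rule singular_simplex_orbit_simplex) (auto simp: topspace_Euclidean_space)

lemma singular_face_orbit_simplex:
  assumes "1 \<le> p" "m \<le> p"
  shows "singular_face p m (orbit_simplex p w)
       = orbit_simplex (p - 1) (\<lambda>j. if j < m then w j else w (Suc j))"
  using singular_face_simplex_map_oriented_simplex[OF assms] by (simp add: orbit_simplex_def)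

lemma orbit_simplex_cong:
  "(\<And>l. l \<le> p \<Longrightarrow> w l = w' l) \<Longrightarrow> orbit_simplex p w = orbit_simplex p w'"
  unfolding orbit_simplex_def using oriented_simplex_eq by metis

text \<open>Barycentric coordinates sum to 1, so moving all vertices by \<open>z\<close> moves every
  point of the simplex by \<open>z\<close>, and \<open>orbit_exp\<close> does not see this because
  \<open>z\<close> fixes \<open>x0\<close>.\<close>

lemma orbit_simplex_translate:
  assumes w: "\<And>l. l \<le> p \<Longrightarrow> w l \<in> topspace (Euclidean_space k)"
    and z: "z \<in> topspace (Euclidean_space k)" "orbit_exp z = x0"
    and w': "\<And>l. l \<le> p \<Longrightarrow> w' l = (\<lambda>i. w l i + z i)"
  shows "orbit_simplex p w' = orbit_simplex p w"
proof -
  have "orbit_exp (\<lambda>i. \<Sum>j\<le>p. w' j i * t j) = orbit_exp (\<lambda>i. \<Sum>j\<le>p. w j i * t j)"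
    if "t \<in> standard_simplex p" for t
  proof -
    have "(\<lambda>i. \<Sum>j\<le>p. w' j i * t j) = (\<lambda>i. (\<Sum>j\<le>p. w j i * t j) + z i)"
    proof
      fix i
      have "(\<Sum>j\<le>p. w' j i * t j) = (\<Sum>j\<le>p. w j i * t j + z i * t j)"
        by (rule sum.cong) (auto simp: w' algebra_simps)
      then show "(\<Sum>j\<le>p. w' j i * t j) = (\<Sum>j\<le>p. w j i * t j) + z i"
        using that by (simp add: sum.distrib standard_simplex_def flip: sum_distrib_left)
    qed
    moreover have "(\<lambda>i. \<Sum>j\<le>p. w j i * t j) \<in> topspace (Euclidean_space k)"
      using w by (simp add: topspace_Euclidean_space)
    ultimately show ?thesis
      using orbit_exp_stabilizer z by simp
  qed
  then show ?thesis
    unfolding orbit_simplex_def simplex_map_def oriented_simplex_def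
    by (intro restrict_ext) simp
qed

text \<open>The edge is the image of the segment from \<open>w a\<close> to \<open>w b\<close>; as
  \<open>w a\<close> fixes \<open>x0\<close>, translation makes it start at the origin.\<close>

lemma edge_orbit_simplex:
  assumes "\<And>l. l \<le> p \<Longrightarrow> w l \<in> topspace (Euclidean_space k)" "a \<le> p" "b \<le> p" "orbit_exp (w a) = x0"
  shows "edge a b (orbit_simplex p w) = orbit_path (\<lambda>i. w b i - w a i)"
proof -
  have "edge a b (orbit_simplex p w) = orbit_simplex 1 (\<lambda>l. w (if l = 0 then a else b))"
    unfolding edge_def orbit_simplex_def
    by (rule subsimplex_simplex_map_oriented_simplex) (use assms in auto)
  also have "\<dots> = orbit_path (\<lambda>i. w b i - w a i)"
    unfolding orbit_path_eq
    by (rule orbit_simplex_translate[where z = "w a"])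
      (use assms in \<open>auto simp: topspace_Euclidean_space\<close>)
  finally show ?thesis .
qed

lemma singular_relcycle_orbit_path:
  assumes v: "v \<in> topspace (Euclidean_space k)" "orbit_exp v = x0"
  shows "singular_relcycle 1 X {} (frag_of (orbit_path v))"
proof -
  have "orbit_simplex 0 (\<lambda>_. v) = orbit_simplex 0 (\<lambda>_ _. 0)"
    by (rule orbit_simplex_translate[where z = v]) (use v in \<open>auto simp: topspace_Euclidean_space\<close>)
  moreover have "singular_face 1 0 (orbit_path v) = orbit_simplex 0 (\<lambda>_. v)"
    "singular_face 1 1 (orbit_path v) = orbit_simplex 0 (\<lambda>_ _. 0)"
    unfolding orbit_path_eq by (auto simp: singular_face_orbit_simplex intro!: orbit_simplex_cong)
  ultimately have "chain_boundary 1 (frag_of (orbit_path v)) = 0"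
    by (simp add: chain_boundary_of)
  then show ?thesis
    using singular_simplex_orbit_path[OF v(1)] by (simp add: singular_cycle singular_chain_of)
qed

end

lemma unit_vector_in_Euclidean_space: "m < k \<Longrightarrow> unit_vector m \<in> topspace (Euclidean_space k)"
  by (simp add: unit_vector_def topspace_Euclidean_space)

lemma singular_relcycle_torus_loop:
  assumes "m < k"
  shows "singular_relcycle 1 (torus k) {} (frag_of (simplex_map 1 torus_exp (linear_path (unit_vector m))))"
proof -
  let ?\<sigma> = "simplex_map 1 torus_exp (linear_path (unit_vector m))"
  \<comment> \<open>Both ends of the segment are integer vectors, so both faces of the loop are the
    constant 0-simplex at \<open>torus_one\<close>.\<close>
  have "simplex_map 0 torus_exp (oriented_simplex 0 w) = restrict (\<lambda>_. torus_one) (standard_simplex 0)"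
    if "\<And>i. w 0 i \<in> \<int>" for w
    using torus_exp_int[of "w 0"] that
    by (auto simp: simplex_map_def oriented_simplex_def standard_simplex_0 fun_eq_iff restrict_def)
  then have "singular_face 1 0 ?\<sigma> = singular_face 1 1 ?\<sigma>"
    unfolding linear_path_def
    by (simp add: singular_face_simplex_map_oriented_simplex unit_vector_def)
  then have "chain_boundary 1 (frag_of ?\<sigma>) = 0"
    by (simp add: chain_boundary_of)
  moreover have "singular_simplex 1 (torus k) ?\<sigma>"
    by (rule singular_simplex_simplex_map[OF singular_simplex_linear_path continuous_map_torus_exp])
      (rule unit_vector_in_Euclidean_space[OF assms])
  ultimately show ?thesis
    by (simp add: singular_cycle singular_chain_of)
qed

section \<open>Rational cocycles dual to the orbit loops\<close>

context torus_orbit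
begin

text \<open>The combination is the image of the same combination \<open>c\<close> of torus loops, so
  the class of \<open>c\<close> is sent to zero. Injectivity makes \<open>c\<close> a boundary in
  the torus, where the windings give the coefficients.\<close>

lemma orbit_loops_independent:
  assumes inj: "homologically_injective k X act x0"
    and bd: "singular_relboundary 1 X {} (\<Sum>m<k. frag_cmul (a m) (frag_of (orbit_path (unit_vector m))))"
    and i: "i < k"
  shows "a i = 0"
proof -
  let ?ev = "\<lambda>t. act t x0"
  let ?cls = "homologous_rel_set 1 (torus k) {}"
  let ?ind = "Defs.hom_induced 1 (torus k) X ?ev"
  define c where "c = (\<Sum>m<k. frag_cmul (a m) (frag_of (simplex_map 1 torus_exp (linear_path (unit_vector m)))))"
  have c: "singular_relcycle 1 (torus k) {} c"
    unfolding c_def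
    by (intro singular_relcycle_sum singular_relcycle_cmul singular_relcycle_torus_loop) auto
  \<comment> \<open>The induced map picks an arbitrary representative of a class; chain maps
    preserve boundaries, so any representative gives the same image class.\<close>
  have ind: "?ind (?cls d) = homologous_rel_set 1 X {} (chain_map 1 ?ev d)" for d
  proof -
    define d' where "d' = (SOME c. c \<in> ?cls d)"
    have "d' \<in> ?cls d"
      unfolding d'_def by (rule someI[of _ d]) simp
    then have "singular_relboundary 1 (torus k) {} (d - d')"
      by (simp add: homologous_rel_def)
    then have "singular_relboundary 1 X {} (chain_map 1 ?ev (d - d'))"
      by (rule singular_relboundary_chain_map[OF _ continuous_map_orbit]) auto
    then have "homologous_rel 1 X {} (chain_map 1 ?ev d) (chain_map 1 ?ev d')"
      by (simp add: homologous_rel_def chain_map_diff)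
    then show ?thesis
      unfolding hom_induced_Defs d'_def[symmetric] homologous_rel_set_eq
      by (rule homologous_rel_sym[THEN iffD1])
  qed
  have "chain_map 1 ?ev c = (\<Sum>m<k. frag_cmul (a m) (frag_of (orbit_path (unit_vector m))))"
  proof -
    have "orbit_exp = ?ev \<circ> torus_exp"
      by (simp add: fun_eq_iff orbit_exp_def)
    then show ?thesis
      by (simp add: c_def chain_map_sum orbit_path_def simplex_map_compose)
  qed
  then have "?ind (?cls c) = ?ind (?cls 0)"
    unfolding ind homologous_rel_set_eq using bd by (simp add: homologous_rel_def)
  moreover have "?cls d \<in> carrier (Defs.homology_group 1 (torus k))"
    if "singular_relcycle 1 (torus k) {} d" for d
    unfolding homology_group_Defs carrier_relative_homology_group using that by blast
  ultimately have "?cls c = ?cls 0"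
    using inj c unfolding homologically_injective_def by (metis inj_onD singular_relcycle_0)
  then have "singular_relboundary 1 (torus k) {} c"
    unfolding homologous_rel_set_eq by (simp add: homologous_rel_def)
  then show ?thesis
    unfolding c_def using i by (rule torus_loops_independent)
qed

text \<open>A rational functional on chains that kills boundaries restricts to a cocycle on
  simplices. It is made to vanish on the other loops by enlarging the subgroup that it
  kills.\<close>

lemma dual_cocycles:
  assumes inj: "homologically_injective k X act x0"
  obtains \<phi> :: "nat \<Rightarrow> ((nat \<Rightarrow> real) \<Rightarrow> 'a) \<Rightarrow> rat"
  where "\<And>i. i < k \<Longrightarrow> cocycle1 X (\<phi> i)"
    "\<And>i m. \<lbrakk>i < k; m < k\<rbrakk> \<Longrightarrow> \<phi> i (orbit_path (unit_vector m)) = (if i = m then 1 else 0)"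
proof -
  let ?c = "\<lambda>a. \<Sum>m<k. frag_cmul (a m) (frag_of (orbit_path (unit_vector m)))"
  have "\<exists>f. cocycle1 X f \<and> (\<forall>m<k. f (orbit_path (unit_vector m)) = (if i = m then 1 else (0::rat)))"
    if i: "i < k" for i
  proof -
    \<comment> \<open>The subgroup generated by the boundaries and the loops other than the one
      numbered \<open>i\<close>; the condition \<open>a i = 0\<close> excludes that loop.\<close>
    define B where "B = {c. \<exists>a. a i = 0 \<and> singular_relboundary 1 X {} (c - ?c a)}"
    have bdB: "b \<in> B" if "singular_relboundary 1 X {} b" for b
      unfolding B_def using that by (auto intro!: exI[of _ "\<lambda>_. 0"])
    have single: "?c (\<lambda>l. if l = m then n else 0) = frag_cmul n (frag_of (orbit_path (unit_vector m)))"
      if "m < k" for m n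
    proof -
      have "?c (\<lambda>l. if l = m then n else 0)
          = (\<Sum>l<k. if l = m then frag_cmul n (frag_of (orbit_path (unit_vector m))) else 0)"
        by (rule sum.cong) auto
      then show ?thesis using that by simp
    qed
    have loopB: "frag_of (orbit_path (unit_vector m)) \<in> B" if "m < k" "m \<noteq> i" for m
      unfolding B_def using that single[of m 1] by (auto intro!: exI[of _ "\<lambda>l. if l = m then 1 else 0"])
    have lin: "?c a - ?c b = ?c (\<lambda>m. a m - b m)" for a b
      by (simp add: frag_cmul_diff_distrib sum_subtractf)
    obtain F :: "'a chain \<Rightarrow> rat" where F: "\<And>x y. F (x + y) = F x + F y"
        "\<And>b. b \<in> B \<Longrightarrow> F b = 0" "F (frag_of (orbit_path (unit_vector i))) = 1"
    proof (rule rational_functional[of B "frag_of (orbit_path (unit_vector i))"])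
      show "0 \<in> B" by (rule bdB) simp
      show "x - y \<in> B" if xy: "x \<in> B" "y \<in> B" for x y
      proof -
        from xy obtain a b where ab: "a i = 0" "b i = 0" "singular_relboundary 1 X {} (x - ?c a)"
          "singular_relboundary 1 X {} (y - ?c b)"
          unfolding B_def by blast
        have "singular_relboundary 1 X {} ((x - ?c a) - (y - ?c b))"
          using ab singular_relboundary_diff by blast
        moreover have "(x - ?c a) - (y - ?c b) = (x - y) - (?c a - ?c b)"
          by (simp only: algebra_simps)
        ultimately have "singular_relboundary 1 X {} ((x - y) - ?c (\<lambda>m. a m - b m))"
          by (simp only: lin)
        then show ?thesis
          unfolding B_def using ab by (auto intro!: exI[of _ "\<lambda>m. a m - b m"])
      qed
      \<comment> \<open>A multiple of loop \<open>i\<close> in \<open>B\<close> is a homology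
        relation among all loops with coefficient \<open>n\<close> at \<open>i\<close>, so
        independence gives \<open>n = 0\<close>.\<close>
      show "n = 0" if n: "frag_cmul n (frag_of (orbit_path (unit_vector i))) \<in> B" for n
      proof -
        from n obtain a where a: "a i = 0"
          "singular_relboundary 1 X {} (frag_cmul n (frag_of (orbit_path (unit_vector i))) - ?c a)"
          unfolding B_def by blast
        then have "singular_relboundary 1 X {} (?c (\<lambda>m. (if m = i then n else 0) - a m))"
          by (simp only: single[OF i, symmetric] lin)
        from orbit_loops_independent[OF inj this i] show ?thesis
          using a(1) by simp
      qed
    qed (use that in blast)
    have Fcmul: "F (- x) = - F x" for x
      using F(1)[of x "- x"] F(1)[of 0 0] by simp
    have "cocycle1 X (\<lambda>\<sigma>. F (frag_of \<sigma>))"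
      unfolding cocycle1_def
    proof (intro allI impI)
      fix \<tau> assume "singular_simplex 2 X \<tau>"
      then have "singular_relboundary 1 X {} (chain_boundary 2 (frag_of \<tau>))"
        unfolding singular_boundary
        by (intro exI[of _ "frag_of \<tau>"]) (simp add: numeral_2_eq_2 singular_chain_of)
      then have "F (chain_boundary 2 (frag_of \<tau>)) = 0"
        using bdB F(2) by blast
      moreover have "chain_boundary 2 (frag_of \<tau>) = frag_of (singular_face 2 0 \<tau>)
          + - frag_of (singular_face 2 1 \<tau>) + frag_of (singular_face 2 2 \<tau>)"
        by (simp add: chain_boundary_of numeral_2_eq_2)
      ultimately show "F (frag_of (singular_face 2 1 \<tau>))
          = F (frag_of (singular_face 2 2 \<tau>)) + F (frag_of (singular_face 2 0 \<tau>))"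
        by (simp only: F(1) Fcmul)
    qed
    then show ?thesis
      using F(2)[OF loopB] F(3) by (intro exI[of _ "\<lambda>\<sigma>. F (frag_of \<sigma>)"]) auto
  qed
  then show thesis
    using that by metis
qed

section \<open>Cube cycles, their cup pairing and the binomial bound\<close>

definition vertex :: "(nat \<Rightarrow> nat) \<Rightarrow> nat \<Rightarrow> nat \<Rightarrow> real" where
  "vertex f l = (\<lambda>i. \<Sum>m<l. unit_vector (f m) i)"

lemma vertex_in_Euclidean_space:
  "(\<And>m. m < l \<Longrightarrow> f m < k) \<Longrightarrow> vertex f l \<in> topspace (Euclidean_space k)"
  unfolding vertex_def topspace_Euclidean_space unit_vector_def
  by (force intro!: sum.neutral)

lemma orbit_exp_vertex: "orbit_exp (vertex f l) = x0"
  by (rule orbit_exp_int) (auto simp: vertex_def unit_vector_def intro!: Ints_sum)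

lemma vertex_cong: "(\<And>m. m < l \<Longrightarrow> f m = g m) \<Longrightarrow> vertex f l = vertex g l"
  by (auto simp: vertex_def intro!: sum.cong)

lemma vertex_permute: "q permutes {..<l} \<Longrightarrow> vertex (f \<circ> q) l = vertex f l"
  unfolding vertex_def by (rule ext) (subst sum.permute[of q], auto simp: o_def)

text \<open>The Kuhn triangulation of the unit cube in the directions \<open>\<iota>\<close>, mapped
  to the orbit: each order \<open>\<pi>\<close> of the directions gives the lattice path of partial
  sums from the origin to the opposite corner. Signs orient the simplices coherently.\<close>

definition torus_cycle :: "nat \<Rightarrow> (nat \<Rightarrow> nat) \<Rightarrow> 'a chain" where
  "torus_cycle j \<iota> = (\<Sum>\<pi> | \<pi> permutes {..<j}.
     frag_cmul (sign \<pi>) (frag_of (orbit_simplex j (vertex (\<iota> \<circ> \<pi>)))))"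

text \<open>The cube decomposed into simplices: inner faces cancel in pairs under a transposition, and
  opposite outer faces agree in the torus up to a cyclic shift.\<close>

lemma singular_relcycle_torus_cycle:
  assumes \<iota>: "\<And>m. m < j \<Longrightarrow> \<iota> m < k"
  shows "singular_relcycle j X {} (torus_cycle j \<iota>)"
proof -
  have idx: "(\<iota> \<circ> \<pi>) m < k" if "\<pi> permutes {..<j}" "m < j" for \<pi> m
    using \<iota> that permutes_in_image[OF that(1), of m] by simp
  have "singular_simplex j X (orbit_simplex j (vertex (\<iota> \<circ> \<pi>)))" if "\<pi> permutes {..<j}" for \<pi>
    by (intro singular_simplex_orbit_simplex vertex_in_Euclidean_space idx[OF that]) auto
  then have chain: "singular_chain j X (torus_cycle j \<iota>)"
    unfolding torus_cycle_def
    by (auto intro!: singular_chain_sum singular_chain_cmul simp: singular_chain_of)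
  have "chain_boundary j (torus_cycle j \<iota>) = 0"
  proof (cases j)
    case 0
    then show ?thesis by (simp add: chain_boundary_def)
  next
    case (Suc n)
    define f where "f \<equiv> \<lambda>m \<pi>. frag_of (orbit_simplex n (\<lambda>l. vertex (\<iota> \<circ> \<pi>) (if l < m then l else Suc l)))"
    define T where "T \<equiv> \<lambda>m. \<Sum>\<pi> | \<pi> permutes {..<j}. frag_cmul (sign \<pi>) (f m \<pi>)"
    have "chain_boundary j (torus_cycle j \<iota>)
        = (\<Sum>\<pi> | \<pi> permutes {..<j}. \<Sum>m\<le>j. frag_cmul ((-1) ^ m) (frag_cmul (sign \<pi>) (f m \<pi>)))"
      unfolding torus_cycle_def chain_boundary_sum o_def[of "chain_boundary j"]
    proof (rule sum.cong)
      fix \<pi>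
      have "frag_of (singular_face j m (orbit_simplex j (vertex (\<iota> \<circ> \<pi>)))) = f m \<pi>" if "m \<le> j" for m
        using that unfolding f_def
        by (subst singular_face_orbit_simplex) (auto simp: Suc intro!: arg_cong[of _ _ frag_of] orbit_simplex_cong)
      then show "chain_boundary j (frag_cmul (sign \<pi>) (frag_of (orbit_simplex j (vertex (\<iota> \<circ> \<pi>)))))
          = (\<Sum>m\<le>j. frag_cmul ((-1) ^ m) (frag_cmul (sign \<pi>) (f m \<pi>)))"
        using Suc by (auto simp: chain_boundary_cmul chain_boundary_of frag_cmul_sum mult.commute simp del: sum.atMost_Suc
            intro!: sum.cong)
    qed simp
    also have "\<dots> = (\<Sum>m\<le>j. frag_cmul ((-1) ^ m) (T m))"
      unfolding T_def frag_cmul_sum by (rule sum.swap)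
    also have "\<dots> = (\<Sum>m\<in>{0, j}. frag_cmul ((-1) ^ m) (T m))"
    proof (rule sum.mono_neutral_right)
      have "T m = 0" if m: "0 < m" "m < j" for m
      proof -
        \<comment> \<open>Swapping the directions \<open>m - 1\<close> and \<open>m\<close> changes
          only vertex \<open>m\<close> of the path, which the face \<open>m\<close> omits. Hence
          \<open>T m\<close> equals its own negative.\<close>
        define q where "q = Transposition.transpose (m - 1) m"
        have q: "q permutes {..<l}" if "m < l" for l
          unfolding q_def using that by (intro permutes_swap_id) auto
        have "f m \<pi> = f m (\<pi> \<circ> q)" for \<pi>
        proof -
          have "vertex (\<iota> \<circ> \<pi>) (if l < m then l else Suc l) = vertex (\<iota> \<circ> (\<pi> \<circ> q)) (if l < m then l else Suc l)" for l
          proof (cases "l < m")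
            case True
            then have "vertex (\<iota> \<circ> \<pi>) l = vertex (\<iota> \<circ> (\<pi> \<circ> q)) l"
              by (intro vertex_cong) (auto simp: q_def Transposition.transpose_def)
            then show ?thesis using True by simp
          next
            case False
            then show ?thesis
              using vertex_permute[OF q, of "Suc l" "\<iota> \<circ> \<pi>"] by (simp add: o_assoc)
          qed
          then show ?thesis by (simp add: f_def)
        qed
        then have "T m = frag_cmul (sign q) (T m)"
          unfolding T_def by (intro sign_permutations_shift q m) auto
        moreover have "sign q = -1"
          using m by (simp add: q_def sign_swap_id)
        ultimately show ?thesis
          by (intro frag_eq_uminus_imp_0) simp
      qed
      then show "\<forall>m\<in>{..j} - {0, j}. frag_cmul ((-1) ^ m) (T m) = 0" by auto
    qed auto
    also have "\<dots> = T 0 + frag_cmul ((-1) ^ j) (T j)"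
      using Suc by simp
    \<comment> \<open>Without vertex 0 the path starts at its first unit vector. Translated back to
      the origin, it is the path in the shifted order without its last vertex, that is, a face with
      index \<open>j\<close>.\<close>
    also have "T 0 = frag_cmul (sign (cyclic_shift n)) (T j)"
      unfolding T_def
    proof (rule sign_permutations_shift)
      show "cyclic_shift n permutes {..<j}" using cyclic_shift Suc by simp
      fix \<pi> assume \<pi>: "\<pi> permutes {..<j}"
      let ?c = "cyclic_shift n"
      have idx': "(\<iota> \<circ> (\<pi> \<circ> ?c)) m < k" if "m < n" for m
        using idx[OF \<pi>, of "Suc m"] that Suc by (simp add: cyclic_shift_def)
      have "orbit_simplex n (\<lambda>l. vertex (\<iota> \<circ> \<pi>) (Suc l)) = orbit_simplex n (vertex (\<iota> \<circ> (\<pi> \<circ> ?c)))"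
      proof (rule orbit_simplex_translate[where z = "unit_vector (\<iota> (\<pi> 0))"])
        show "unit_vector (\<iota> (\<pi> 0)) \<in> topspace (Euclidean_space k)"
          using idx[OF \<pi>, of 0] Suc by (simp add: unit_vector_in_Euclidean_space)
        show "orbit_exp (unit_vector (\<iota> (\<pi> 0))) = x0"
          by (rule orbit_exp_int) (simp add: unit_vector_def)
        fix l assume l: "l \<le> n"
        show "vertex (\<iota> \<circ> (\<pi> \<circ> ?c)) l \<in> topspace (Euclidean_space k)"
          by (rule vertex_in_Euclidean_space) (use idx' l in auto)
        have "vertex (\<iota> \<circ> (\<pi> \<circ> ?c)) l = vertex (\<lambda>m. (\<iota> \<circ> \<pi>) (Suc m)) l"
          using l by (intro vertex_cong) (auto simp: cyclic_shift_def)
        then show "vertex (\<iota> \<circ> \<pi>) (Suc l)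
            = (\<lambda>i. vertex (\<iota> \<circ> (\<pi> \<circ> ?c)) l i + unit_vector (\<iota> (\<pi> 0)) i)"
          by (simp add: vertex_def sum.lessThan_Suc_shift fun_eq_iff del: sum.lessThan_Suc)
      qed
      moreover have "orbit_simplex n (\<lambda>l. vertex (\<iota> \<circ> (\<pi> \<circ> ?c)) (if l < j then l else Suc l))
          = orbit_simplex n (vertex (\<iota> \<circ> (\<pi> \<circ> ?c)))"
        using Suc by (intro orbit_simplex_cong) auto
      ultimately show "f 0 \<pi> = f j (\<pi> \<circ> ?c)"
        by (simp add: f_def)
    qed
    \<comment> \<open>The shift has sign \<open>(-1) ^ n\<close> and \<open>j = Suc n\<close>, so
      the two outer contributions cancel.\<close>
    also have "frag_cmul (sign (cyclic_shift n)) (T j) + frag_cmul ((-1) ^ j) (T j) = 0"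
      using cyclic_shift[of n] Suc by (simp flip: frag_cmul_distrib)
    finally show ?thesis .
  qed
  with chain show ?thesis by (simp add: singular_cycle)
qed

text \<open>Edge \<open>l\<close> of the simplex of \<open>\<pi>\<close> is the orbit loop in
  direction \<open>\<iota> (\<pi> l)\<close>, so the cup product is a product of Kronecker deltas.
  The sum is the determinant of the matrix comparing \<open>\<kappa>\<close> with
  \<open>\<iota>\<close>.\<close>

lemma cup_torus_cycle:
  fixes \<phi> :: "nat \<Rightarrow> ((nat \<Rightarrow> real) \<Rightarrow> 'a) \<Rightarrow> rat"
  assumes \<phi>: "\<And>i m. \<lbrakk>i < k; m < k\<rbrakk> \<Longrightarrow> \<phi> i (orbit_path (unit_vector m)) = (if i = m then 1 else 0)"
    and \<iota>: "\<And>m. m < j \<Longrightarrow> \<iota> m < k" and \<kappa>: "\<And>m. m < j \<Longrightarrow> \<kappa> m < k"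
  shows "cochain_eval (cup1 j (\<lambda>l. \<phi> (\<kappa> l))) (torus_cycle j \<iota>)
       = (\<Sum>\<pi> | \<pi> permutes {..<j}. if \<forall>l<j. \<kappa> l = \<iota> (\<pi> l) then of_int (sign \<pi>) else 0)"
  unfolding torus_cycle_def cochain_eval_sum
proof (rule sum.cong)
  fix \<pi> assume "\<pi> \<in> {\<pi>. \<pi> permutes {..<j}}"
  then have \<pi>: "\<pi> permutes {..<j}" by simp
  have idx: "(\<iota> \<circ> \<pi>) m < k" if "m < j" for m
    using \<iota> that permutes_in_image[OF \<pi>, of m] by simp
  have "\<phi> (\<kappa> l) (edge l (Suc l) (orbit_simplex j (vertex (\<iota> \<circ> \<pi>)))) = (if \<kappa> l = \<iota> (\<pi> l) then 1 else 0)"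
    if l: "l < j" for l
  proof -
    have "edge l (Suc l) (orbit_simplex j (vertex (\<iota> \<circ> \<pi>)))
        = orbit_path (\<lambda>i. vertex (\<iota> \<circ> \<pi>) (Suc l) i - vertex (\<iota> \<circ> \<pi>) l i)"
      using l by (intro edge_orbit_simplex vertex_in_Euclidean_space idx orbit_exp_vertex) auto
    also have "(\<lambda>i. vertex (\<iota> \<circ> \<pi>) (Suc l) i - vertex (\<iota> \<circ> \<pi>) l i) = unit_vector (\<iota> (\<pi> l))"
      by (simp add: vertex_def fun_eq_iff)
    finally have e: "edge l (Suc l) (orbit_simplex j (vertex (\<iota> \<circ> \<pi>))) = orbit_path (unit_vector (\<iota> (\<pi> l)))" .
    show ?thesis
      unfolding e using \<phi>[OF \<kappa>[OF l] idx[OF l]] by simp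
  qed
  then have "cup1 j (\<lambda>l. \<phi> (\<kappa> l)) (orbit_simplex j (vertex (\<iota> \<circ> \<pi>))) = (\<Prod>l<j. if \<kappa> l = \<iota> (\<pi> l) then 1 else 0)"
    unfolding cup1_def by (intro prod.cong) auto
  also have "\<dots> = (if \<forall>l<j. \<kappa> l = \<iota> (\<pi> l) then 1 else 0)"
    by (auto intro: prod.neutral)
  finally show "cochain_eval (cup1 j (\<lambda>l. \<phi> (\<kappa> l))) (frag_cmul (sign \<pi>) (frag_of (orbit_simplex j (vertex (\<iota> \<circ> \<pi>)))))
     = (if \<forall>l<j. \<kappa> l = \<iota> (\<pi> l) then of_int (sign \<pi>) else 0)"
    by (simp add: cochain_eval_cmul)
qed simp

text \<open>Indexed by the \<open>j\<close>-subsets of the coordinates, the pairing of cup products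
  with cube cycles is the identity matrix.\<close>

theorem betti_ge_binomial:
  assumes inj: "homologically_injective k X act x0"
  shows "enat (k choose j) \<le> betti j X"
proof -
  obtain \<phi> :: "nat \<Rightarrow> ((nat \<Rightarrow> real) \<Rightarrow> 'a) \<Rightarrow> rat"
    where coc: "\<And>i. i < k \<Longrightarrow> cocycle1 X (\<phi> i)"
      and dual: "\<And>i m. \<lbrakk>i < k; m < k\<rbrakk> \<Longrightarrow> \<phi> i (orbit_path (unit_vector m)) = (if i = m then 1 else 0)"
    using dual_cocycles[OF inj] by blast
  define I where "I = {A. A \<subseteq> {..<k} \<and> card A = j}"
  define en where "en \<equiv> \<lambda>(A::nat set) l. sorted_list_of_set A ! l"
  have fin: "finite A" if "A \<in> I" for A
    using that finite_subset by (auto simp: I_def)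
  have en_img: "en A ` {..<j} = A" and en_inj: "inj_on (en A) {..<j}" if "A \<in> I" for A
  proof -
    have len: "length (sorted_list_of_set A) = j" "set (sorted_list_of_set A) = A"
      using that fin[OF that] by (auto simp: I_def)
    show "en A ` {..<j} = A"
      using len unfolding en_def by (metis lessThan_atLeast0 list.set_map map_nth set_upt)
    show "inj_on (en A) {..<j}"
      using len unfolding en_def by (auto simp: inj_on_def nth_eq_iff_index_eq)
  qed
  have en_less: "en A m < k" if "A \<in> I" "m < j" for A m
    using en_img[OF that(1)] that by (force simp: I_def)
  have "enat (card I) \<le> betti j X"
  proof (rule betti_ge[where c = "\<lambda>A. torus_cycle j (en A)"
        and F = "\<lambda>A. cochain_eval (cup1 j (\<lambda>l. \<phi> (en A l)))"])
    show "finite I"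
      unfolding I_def by (rule finite_subset[of _ "Pow {..<k}"]) auto
    show "singular_relcycle j X {} (torus_cycle j (en A))" if "A \<in> I" for A
      by (intro singular_relcycle_torus_cycle en_less that)
    show "cochain_eval (cup1 j (\<lambda>l. \<phi> (en A l))) b = 0"
      if "A \<in> I" "singular_relboundary j X {} b" for A b
      by (rule cochain_eval_boundary[OF cup1_cocycle that(2)]) (use that coc en_less in auto)
    fix A C assume AC: "A \<in> I" "C \<in> I"
    \<comment> \<open>Comparing images gives \<open>A = C\<close>, and then injectivity of the
      enumeration leaves only the identity, so the determinant has at most one nonzero term.\<close>
    have "(\<forall>l<j. en A l = en C (\<pi> l)) \<longleftrightarrow> A = C \<and> \<pi> = id" if \<pi>: "\<pi> permutes {..<j}" for \<pi>
    proof
      assume eq: "\<forall>l<j. en A l = en C (\<pi> l)"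
      have "A = en A ` {..<j}" using en_img AC by simp
      also have "\<dots> = en C ` \<pi> ` {..<j}"
        using eq by (auto simp: image_iff)
      also have "\<dots> = C"
        using en_img AC permutes_image[OF \<pi>] by simp
      finally have "A = C" .
      moreover have "\<pi> l = l" for l
      proof (cases "l < j")
        case True
        then have "\<pi> l < j" using permutes_in_image[OF \<pi>, of l] by simp
        then show ?thesis
          using eq True \<open>A = C\<close> en_inj[OF AC(2)] by (auto simp: inj_on_def)
      next
        case False
        then show ?thesis using permutes_not_in[OF \<pi>] by simp
      qed
      ultimately show "A = C \<and> \<pi> = id" by auto
    qed auto
    then have "cochain_eval (cup1 j (\<lambda>l. \<phi> (en A l))) (torus_cycle j (en C))
        = (\<Sum>\<pi> | \<pi> permutes {..<j}. if \<pi> = id then (if A = C then 1 else 0) else 0)"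
      by (subst cup_torus_cycle[OF dual])
        (use en_less AC in \<open>auto intro!: sum.cong\<close>)
    also have "\<dots> = (if A = C then 1 else 0)"
      by (subst sum.delta) (auto simp: finite_permutations permutes_id)
    finally show "cochain_eval (cup1 j (\<lambda>l. \<phi> (en A l))) (torus_cycle j (en C)) = (if A = C then 1 else 0)" .
  qed (rule cochain_eval_add)
  then show ?thesis
    unfolding I_def by (simp add: n_subsets)
qed

end

section \<open>The dimension bound\<close>

text \<open>A basic open set of the product topology restricts only finitely many coordinates, so a
  smallest radius exists.\<close>

lemma openin_Euclidean_space_contains_box:
  assumes "openin (Euclidean_space k) V" "(\<lambda>_. 0) \<in> V"
  obtains \<delta> :: real where "\<delta> > 0"
    "\<And>v. \<lbrakk>v \<in> topspace (Euclidean_space k); \<And>i. \<bar>v i\<bar> < \<delta>\<rbrakk> \<Longrightarrow> v \<in> V"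
proof -
  obtain W where W: "openin (powertop_real UNIV) W" "V = W \<inter> topspace (Euclidean_space k)"
    using assms(1) by (auto simp: Euclidean_space_def openin_subtopology)
  have "(\<lambda>_. 0) \<in> W" using assms(2) W(2) by simp
  then obtain Y where Y: "(\<lambda>_. 0) \<in> (\<Pi>\<^sub>E i\<in>UNIV. Y i)" "\<And>i. openin euclideanreal (Y i)"
      "finite {i. Y i \<noteq> topspace euclideanreal}" "(\<Pi>\<^sub>E i\<in>UNIV. Y i) \<subseteq> W"
    using product_topology_open_contains_basis[OF W(1)] by blast
  have "\<exists>d>0. \<forall>y. \<bar>y\<bar> < d \<longrightarrow> y \<in> Y i" for i
  proof -
    have "open (Y i)" "0 \<in> Y i"
      using Y(1,2) by (auto simp: PiE_def)
    then obtain d where "d > 0" "ball 0 d \<subseteq> Y i"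
      using openE by blast
    then show ?thesis
      by (intro exI[of _ d]) (auto simp: subset_iff dist_real_def)
  qed
  then obtain d where d: "\<And>i. d i > 0" "\<And>i y. \<bar>y\<bar> < d i \<Longrightarrow> y \<in> Y i"
    by metis
  \<comment> \<open>The inserted 1 keeps the set nonempty when no coordinate is restricted.\<close>
  define D where "D = insert 1 (d ` {i. Y i \<noteq> UNIV})"
  have D: "finite D" "D \<noteq> {}" using Y(3) by (auto simp: D_def)
  show thesis
  proof
    show "Min D > 0"
      using D d(1) by (auto simp: D_def)
    fix v assume v: "v \<in> topspace (Euclidean_space k)" "\<And>i. \<bar>v i\<bar> < Min D"
    have "v i \<in> Y i" for i
    proof (cases "Y i = UNIV")
      case False
      then have "Min D \<le> d i"
        using D by (intro Min_le) (auto simp: D_def)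
      then show ?thesis
        using v(2)[of i] d(2) by simp
    qed simp
    then have "v \<in> W" using Y(4) by (auto simp: PiE_def)
    then show "v \<in> V" using v W by blast
  qed
qed

lemma openin_Euclidean_space_box: "openin (Euclidean_space k) {v \<in> topspace (Euclidean_space k). \<forall>i<k. \<bar>v i\<bar> < \<delta>}"
proof -
  have "openin (Euclidean_space k) {v \<in> topspace (Euclidean_space k). v i \<in> {- \<delta><..<\<delta>}}" for i
  proof (rule openin_continuous_map_preimage)
    show "continuous_map (Euclidean_space k) euclideanreal (\<lambda>v. v i)"
      unfolding Euclidean_space_def
      by (intro continuous_map_from_subtopology continuous_map_product_projection) auto
  qed simp
  then have "openin (Euclidean_space k)
      ((\<Inter>i\<in>{..<k}. {v \<in> topspace (Euclidean_space k). v i \<in> {- \<delta><..<\<delta>}}) \<inter> topspace (Euclidean_space k))"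
    by (intro openin_INT) auto
  also have "(\<Inter>i\<in>{..<k}. {v \<in> topspace (Euclidean_space k). v i \<in> {- \<delta><..<\<delta>}}) \<inter> topspace (Euclidean_space k)
      = {v \<in> topspace (Euclidean_space k). \<forall>i<k. \<bar>v i\<bar> < \<delta>}"
    by (auto simp: abs_less_iff minus_less_iff)
  finally show ?thesis .
qed

text \<open>A line in direction \<open>n\<close> through a point of \<open>V\<close> would meet
  \<open>V\<close> in that point only, making a singleton open in the reals.\<close>

lemma openin_Euclidean_space_not_subset:
  assumes "openin (Euclidean_space k) V" "V \<noteq> {}" "n < k"
  shows "\<not> V \<subseteq> topspace (Euclidean_space n)"
proof
  assume V: "V \<subseteq> topspace (Euclidean_space n)"
  obtain x where x: "x \<in> V" using assms by blast
  define f where "f \<equiv> \<lambda>t i. x i + t * unit_vector n i"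
  have xk: "x \<in> topspace (Euclidean_space k)" using x V assms openin_subset by blast
  have "continuous_map euclideanreal (powertop_real UNIV) f"
    unfolding continuous_map_componentwise_UNIV f_def by (auto intro!: continuous_intros)
  moreover have "f t \<in> topspace (Euclidean_space k)" for t
    using xk assms(3) by (auto simp: f_def topspace_Euclidean_space unit_vector_def)
  ultimately have "continuous_map euclideanreal (Euclidean_space k) f"
    unfolding Euclidean_space_def continuous_map_in_subtopology by (auto simp: topspace_Euclidean_space)
  then have "openin euclideanreal {t \<in> topspace euclideanreal. f t \<in> V}"
    by (rule openin_continuous_map_preimage[OF _ assms(1)])
  moreover have "{t \<in> topspace euclideanreal. f t \<in> V} = {0}"
  proof -
    have "f 0 = x" by (simp add: f_def)
    moreover have "t = 0" if "f t \<in> V" for t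
    proof -
      have "f t n = 0" "x n = 0" using that x V by (auto simp: topspace_Euclidean_space)
      then show ?thesis by (simp add: f_def unit_vector_def)
    qed
    ultimately show ?thesis using x by auto
  qed
  ultimately have "open {0::real}" by simp
  then show False using not_open_singleton by blast
qed

lemma singular_relboundary_contractible:
  assumes "contractible_space X" "singular_relcycle p X {} c" "p \<noteq> 0"
  shows "singular_relboundary p X {} c"
proof -
  have "trivial_group (homology_group (int p) X)"
    using trivial_reduced_homology_group_contractible_space[OF assms(1), of "int p"] assms(3)
    by (simp add: un_reduced_homology_group)
  then have "carrier (homology_group (int p) X) = {singular_relboundary_set p X {}}"
    by (simp add: trivial_group_def)
  moreover have "homologous_rel_set p X {} c \<in> carrier (homology_group (int p) X)"
    unfolding carrier_relative_homology_group using assms(2) by blast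
  ultimately show ?thesis
    by (simp add: homologous_rel_set_eq_relboundary)
qed

section \<open>Homology of the loops given by stabilizer elements\<close>

context torus_orbit
begin

text \<open>The preimage in Euclidean space of the isotropy group of \<open>x0\<close>. It contains
  the integer lattice, and its elements are those whose linear paths become loops at
  \<open>x0\<close>.\<close>

definition stabilizer :: "(nat \<Rightarrow> real) set" where
  "stabilizer = {v \<in> topspace (Euclidean_space k). orbit_exp v = x0}"

lemma int_in_stabilizer:
  assumes "z \<in> topspace (Euclidean_space k)" "\<And>i. z i \<in> \<int>"
  shows "z \<in> stabilizer"
  using assms orbit_exp_int by (simp add: stabilizer_def)

lemma zero_in_stabilizer: "(\<lambda>_. 0) \<in> stabilizer"
  by (rule int_in_stabilizer) (auto simp: topspace_Euclidean_space)

lemma stabilizer_add: "\<lbrakk>u \<in> stabilizer; v \<in> stabilizer\<rbrakk> \<Longrightarrow> (\<lambda>i. u i + v i) \<in> stabilizer"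
  using orbit_exp_stabilizer by (auto simp: stabilizer_def topspace_Euclidean_space)

lemma stabilizer_minus:
  assumes "v \<in> stabilizer"
  shows "(\<lambda>i. - v i) \<in> stabilizer"
proof -
  have v: "v \<in> topspace (Euclidean_space k)" "orbit_exp v = x0"
    using assms by (auto simp: stabilizer_def)
  then have mv: "(\<lambda>i. - v i) \<in> topspace (Euclidean_space k)"
    by (simp add: topspace_Euclidean_space)
  have "orbit_exp (\<lambda>_. 0) = x0" using zero_in_stabilizer by (simp add: stabilizer_def)
  then show ?thesis
    using orbit_exp_stabilizer[OF mv v] mv by (simp add: stabilizer_def)
qed

lemma stabilizer_mult_nat: "v \<in> stabilizer \<Longrightarrow> (\<lambda>i. of_nat n * v i) \<in> stabilizer"
proof (induction n)
  case 0
  then show ?case by (simp add: zero_in_stabilizer)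
next
  case (Suc n)
  then show ?case using stabilizer_add[OF Suc.IH, of v] by (simp add: algebra_simps)
qed

text \<open>The 2-simplex with vertices 0, \<open>u\<close>, \<open>u + v\<close> has these three
  loops as edges: all its vertices lie in the stabilizer, so each edge can be translated to start at
  the origin.\<close>

lemma cocycle1_orbit_path_add:
  assumes f: "cocycle1 X f" and u: "u \<in> stabilizer" and v: "v \<in> stabilizer"
  shows "f (orbit_path (\<lambda>i. u i + v i)) = f (orbit_path u) + f (orbit_path v)"
proof -
  define w where "w = (\<lambda>l::nat. if l = 0 then (\<lambda>_. 0) else if l = 1 then u else (\<lambda>i. u i + v i))"
  have w: "w l \<in> stabilizer" for l
    using u v by (simp add: w_def zero_in_stabilizer stabilizer_add)
  have e: "edge a b (orbit_simplex 2 w) = orbit_path (\<lambda>i. w b i - w a i)" if "a \<le> 2" "b \<le> 2" for a b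
    by (rule edge_orbit_simplex) (use w that in \<open>auto simp: stabilizer_def\<close>)
  have "singular_simplex 2 X (orbit_simplex 2 w)"
    by (rule singular_simplex_orbit_simplex) (use w in \<open>auto simp: stabilizer_def\<close>)
  from cocycle1_edge[OF f this, of 0 1 2] show ?thesis
    by (simp add: e) (simp add: w_def)
qed

lemma cocycle1_orbit_path_zero: "cocycle1 X f \<Longrightarrow> f (orbit_path (\<lambda>_. 0)) = 0"
  using cocycle1_orbit_path_add[OF _ zero_in_stabilizer zero_in_stabilizer] by fastforce

lemma cocycle1_orbit_path_minus:
  assumes "cocycle1 X f" "v \<in> stabilizer"
  shows "f (orbit_path (\<lambda>i. - v i)) = - f (orbit_path v)"
  using cocycle1_orbit_path_add[OF assms stabilizer_minus[OF assms(2)]]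
    cocycle1_orbit_path_zero[OF assms(1)]
  by (simp add: eq_neg_iff_add_eq_0 add.commute)

lemma cocycle1_orbit_path_nat:
  assumes f: "cocycle1 X f" and v: "v \<in> stabilizer"
  shows "f (orbit_path (\<lambda>i. of_nat n * v i)) = of_nat n * f (orbit_path v)"
proof (induction n)
  case 0
  then show ?case by (simp add: cocycle1_orbit_path_zero[OF f])
next
  case (Suc n)
  have "(\<lambda>i. of_nat (Suc n) * v i) = (\<lambda>i. of_nat n * v i + v i)"
    by (simp add: algebra_simps)
  then show ?case
    using cocycle1_orbit_path_add[OF f stabilizer_mult_nat[OF v] v] Suc.IH by (simp add: algebra_simps)
qed

lemma cocycle1_orbit_path_int:
  assumes f: "cocycle1 X f" and v: "v \<in> stabilizer"
  shows "f (orbit_path (\<lambda>i. of_int n * v i)) = of_int n * f (orbit_path v)"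
proof (cases n rule: int_cases2)
  case (nonneg m)
  then show ?thesis using cocycle1_orbit_path_nat[OF assms, of m] by simp
next
  case (nonpos m)
  then show ?thesis
    using cocycle1_orbit_path_minus[OF f stabilizer_mult_nat[OF v, of m]]
      cocycle1_orbit_path_nat[OF assms, of m] by simp
qed

text \<open>By additivity the cocycle is determined on lattice loops by its values on unit vectors;
  the induction adds one coordinate at a time.\<close>

lemma dual_cocycle_int_vector:
  fixes f :: "((nat \<Rightarrow> real) \<Rightarrow> 'a) \<Rightarrow> rat"
  assumes f: "cocycle1 X f" and dual: "\<And>m. m < k \<Longrightarrow> f (orbit_path (unit_vector m)) = (if i = m then 1 else 0)"
    and "i < k"
  shows "f (orbit_path (\<lambda>m. if m < k then of_int (z m) else 0)) = of_int (z i)"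
proof -
  have "f (orbit_path (\<lambda>m. if m < q then of_int (z m) else 0)) = (if i < q then of_int (z i) else 0)"
    if "q \<le> k" for q
    using that
  proof (induction q)
    case 0
    then show ?case by (simp add: cocycle1_orbit_path_zero[OF f])
  next
    case (Suc q)
    let ?z = "\<lambda>m. if m < q then real_of_int (z m) else 0"
    have uv: "unit_vector q \<in> stabilizer"
      by (rule int_in_stabilizer[OF unit_vector_in_Euclidean_space]) (use Suc.prems in \<open>auto simp: unit_vector_def\<close>)
    have zq: "?z \<in> stabilizer"
      by (rule int_in_stabilizer) (use Suc.prems in \<open>auto simp: topspace_Euclidean_space\<close>)
    have zu: "(\<lambda>m. of_int (z q) * unit_vector q m) \<in> stabilizer"
      by (rule int_in_stabilizer) (use Suc.prems in \<open>auto simp: topspace_Euclidean_space unit_vector_def\<close>)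
    have "(\<lambda>m. if m < Suc q then real_of_int (z m) else 0) = (\<lambda>m. ?z m + of_int (z q) * unit_vector q m)"
      by (auto simp: fun_eq_iff unit_vector_def less_Suc_eq)
    then have "f (orbit_path (\<lambda>m. if m < Suc q then of_int (z m) else 0))
        = f (orbit_path ?z) + of_int (z q) * f (orbit_path (unit_vector q))"
      using cocycle1_orbit_path_add[OF f zq zu] cocycle1_orbit_path_int[OF f uv] by simp
    also have "\<dots> = (if i < Suc q then of_int (z i) else 0)"
      using Suc dual[of q] by (auto simp: less_Suc_eq)
    finally show ?case .
  qed
  from this[of k] show ?thesis using \<open>i < k\<close> by simp
qed

text \<open>The box is star-shaped about the origin, so the whole loop of a small stabilizer element
  stays in \<open>U\<close>, where every 1-cycle bounds.\<close>

lemma small_orbit_path_boundary: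
  assumes U: "openin X U" "x0 \<in> U" "contractible_space (subtopology X U)"
  obtains \<delta> :: real where "\<delta> > 0"
    "\<And>v. \<lbrakk>v \<in> topspace (Euclidean_space k); \<And>i. \<bar>v i\<bar> < \<delta>\<rbrakk> \<Longrightarrow> orbit_exp v \<in> U"
    "\<And>v. \<lbrakk>v \<in> stabilizer; \<And>i. \<bar>v i\<bar> < \<delta>\<rbrakk> \<Longrightarrow> singular_relboundary 1 X {} (frag_of (orbit_path v))"
proof -
  have "openin (Euclidean_space k) {v \<in> topspace (Euclidean_space k). orbit_exp v \<in> U}"
    by (rule openin_continuous_map_preimage[OF continuous_map_orbit_exp U(1)])
  moreover have "(\<lambda>_. 0) \<in> {v \<in> topspace (Euclidean_space k). orbit_exp v \<in> U}"
    using zero_in_stabilizer U(2) by (simp add: stabilizer_def)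
  ultimately obtain \<delta> where \<delta>: "\<delta> > 0"
    "\<And>v. \<lbrakk>v \<in> topspace (Euclidean_space k); \<And>i. \<bar>v i\<bar> < \<delta>\<rbrakk> \<Longrightarrow> orbit_exp v \<in> U"
    by (rule openin_Euclidean_space_contains_box) blast
  show thesis
  proof (rule that[OF \<delta>])
    fix v assume v: "v \<in> stabilizer" and small: "\<And>i. \<bar>v i\<bar> < \<delta>"
    have vE: "v \<in> topspace (Euclidean_space k)" "orbit_exp v = x0"
      using v by (auto simp: stabilizer_def)
    have "orbit_path v t \<in> U" if t: "t \<in> standard_simplex 1" for t
    proof -
      have t1: "0 \<le> t 1" "t 1 \<le> 1" using t by (auto simp: standard_simplex_def)
      have "orbit_path v t = orbit_exp (\<lambda>i. v i * t 1)"
        using t by (simp add: orbit_path_def simplex_map_def linear_path_def oriented_simplex_def)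
      moreover have "\<bar>v i * t 1\<bar> < \<delta>" for i
        using mult_left_mono[OF t1(2), of "\<bar>v i\<bar>"] small[of i] t1 by (simp add: abs_mult)
      moreover have "(\<lambda>i. v i * t 1) \<in> topspace (Euclidean_space k)"
        using vE by (simp add: topspace_Euclidean_space)
      ultimately show ?thesis using \<delta>(2) by simp
    qed
    then have "singular_relcycle 1 (subtopology X U) {} (frag_of (orbit_path v))"
      using singular_relcycle_orbit_path[OF vE]
      by (auto simp: singular_cycle singular_chain_of singular_simplex_subtopology)
    then have "singular_relboundary 1 (subtopology X U) {} (frag_of (orbit_path v))"
      by (intro singular_relboundary_contractible U(3)) auto
    then show "singular_relboundary 1 X {} (frag_of (orbit_path v))"
      using singular_boundary_mono[of U UNIV] by fastforce
  qed
qed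

text \<open>A small nonzero stabilizer element has, by Dirichlet, a multiple close to a nonzero
  lattice vector; as small stabilizer loops are null-homologous, so is that lattice loop.\<close>

lemma stabilizer_discrete:
  assumes inj: "homologically_injective k X act x0" and "\<delta> > 0"
    and small: "\<And>v. \<lbrakk>v \<in> stabilizer; \<And>i. \<bar>v i\<bar> < \<delta>\<rbrakk> \<Longrightarrow> singular_relboundary 1 X {} (frag_of (orbit_path v))"
    and v: "v \<in> stabilizer" "\<And>i. \<bar>v i\<bar> < \<delta>"
  shows "v i = 0"
proof (rule ccontr)
  assume nz: "v i \<noteq> 0"
  then have ik: "i < k"
    using v(1) by (auto simp: stabilizer_def topspace_Euclidean_space not_less[symmetric])
  obtain \<phi> :: "nat \<Rightarrow> ((nat \<Rightarrow> real) \<Rightarrow> 'a) \<Rightarrow> rat"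
    where coc: "\<And>i. i < k \<Longrightarrow> cocycle1 X (\<phi> i)"
      and dual: "\<And>i m. \<lbrakk>i < k; m < k\<rbrakk> \<Longrightarrow> \<phi> i (orbit_path (unit_vector m)) = (if i = m then 1 else 0)"
    using dual_cocycles[OF inj] by blast
  have small0: "\<phi> i (orbit_path u) = 0" if "u \<in> stabilizer" "\<And>i. \<bar>u i\<bar> < \<delta>" for u
    using cocycle1_boundary[OF coc[OF ik] small[OF that]] by simp
  \<comment> \<open>Scaling by \<open>N\<close> gives \<open>N * v i\<close> absolute value at least
    1; this later keeps the approximating integer \<open>p i\<close> from being zero.\<close>
  obtain N :: nat where N: "1 / \<bar>v i\<bar> \<le> real N"
    using real_arch_simple by blast
  have "0 < min \<delta> 1" using \<open>\<delta> > 0\<close> by simp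
  \<comment> \<open>The bound by \<open>\<delta>\<close> makes the approximation error a small
    vector; the bound by 1 is for the final contradiction.\<close>
  then obtain M :: nat where M: "M > 0" "1 / real M < min \<delta> 1"
    using nat_approx_posE by (metis zero_less_Suc)
  obtain q p where q: "0 < q" and p: "\<And>l. l < k \<Longrightarrow> \<bar>of_int q * (real N * v l) - of_int (p l)\<bar> < 1 / M"
    using Dirichlet_approx_simult[OF M(1), of k "\<lambda>l. real N * v l"] by metis
  define n where "n = nat q * N"
  have n: "real n * v l = of_int q * (real N * v l)" for l
    using q by (simp add: n_def)
  define z where "z = (\<lambda>l. if l < k then real_of_int (p l) else 0)"
  \<comment> \<open>The approximation error, a small stabilizer element. The cocycle vanishes on it
    and on \<open>v\<close>, hence on the lattice vector \<open>z\<close>, where its value is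
    \<open>p i\<close>.\<close>
  define w where "w = (\<lambda>l. real n * v l + - z l)"
  have z: "z \<in> stabilizer"
    by (rule int_in_stabilizer) (auto simp: z_def topspace_Euclidean_space)
  have w: "w \<in> stabilizer"
    unfolding w_def by (rule stabilizer_add[OF stabilizer_mult_nat[OF v(1)] stabilizer_minus[OF z]])
  have "\<bar>w l\<bar> < \<delta>" for l
  proof (cases "l < k")
    case True
    then show ?thesis using p[of l] M(2) by (simp add: w_def z_def n)
  next
    case False
    then have "w l = 0"
      using w by (simp add: stabilizer_def topspace_Euclidean_space)
    then show ?thesis using \<open>\<delta> > 0\<close> by simp
  qed
  then have "\<phi> i (orbit_path w) = 0"
    using small0 w by blast
  moreover have "\<phi> i (orbit_path w) = of_nat n * \<phi> i (orbit_path v) + - \<phi> i (orbit_path z)"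
    unfolding w_def
    using cocycle1_orbit_path_add[OF coc[OF ik] stabilizer_mult_nat[OF v(1), of n] stabilizer_minus[OF z]]
      cocycle1_orbit_path_nat[OF coc[OF ik] v(1), of n] cocycle1_orbit_path_minus[OF coc[OF ik] z]
    by simp
  moreover have "\<phi> i (orbit_path v) = 0"
    using small0 v by blast
  moreover have "\<phi> i (orbit_path z) = of_int (p i)"
    unfolding z_def by (rule dual_cocycle_int_vector[OF coc[OF ik] dual ik]) (use ik in auto)
  ultimately have "p i = 0" by simp
  then have "\<bar>of_int q * (real N * v i)\<bar> < 1"
    using p[OF ik] M(2) by simp
  moreover have "1 \<le> \<bar>real N * v i\<bar>"
    using N nz by (simp add: abs_mult field_simps)
  then have "1 * 1 \<le> \<bar>real_of_int q\<bar> * \<bar>real N * v i\<bar>"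
    using q by (intro mult_mono) auto
  ultimately show False by (simp add: abs_mult)
qed

text \<open>If \<open>n < k\<close>, a chart around \<open>x0\<close> composed with
  \<open>orbit_exp\<close> embeds an open box of dimension \<open>k\<close> into the coordinate
  subspace of dimension \<open>n\<close>. By invariance of domain the image is open in dimension
  \<open>k\<close>, which is impossible.\<close>

lemma dimension_bound:
  assumes inj: "homologically_injective k X act x0" and mf: "closed_manifold n X"
  shows "k \<le> n"
proof (rule ccontr)
  assume "\<not> k \<le> n"
  then have nk: "n < k" by simp
  obtain U where U: "openin X U" "x0 \<in> U" "(subtopology X U) homeomorphic_space (Euclidean_space n)"
    using mf x0 unfolding closed_manifold_def by blast
  then have "contractible_space (subtopology X U)"
    using homeomorphic_space_contractibility contractible_Euclidean_space by blast
  then obtain \<delta> :: real where \<delta>: "\<delta> > 0"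
    "\<And>v. \<lbrakk>v \<in> topspace (Euclidean_space k); \<And>i. \<bar>v i\<bar> < \<delta>\<rbrakk> \<Longrightarrow> orbit_exp v \<in> U"
    "\<And>v. \<lbrakk>v \<in> stabilizer; \<And>i. \<bar>v i\<bar> < \<delta>\<rbrakk> \<Longrightarrow> singular_relboundary 1 X {} (frag_of (orbit_path v))"
    by (rule small_orbit_path_boundary[OF U(1,2)]) blast
  obtain h where h: "homeomorphic_map (subtopology X U) (Euclidean_space n) h"
    using U(3) by (auto simp: homeomorphic_space)
  \<comment> \<open>Half the radius, so that differences of points of \<open>W\<close> stay within
    \<open>\<delta>\<close>, where the stabilizer contains only the origin.\<close>
  define W where "W = {v \<in> topspace (Euclidean_space k). \<forall>i<k. \<bar>v i\<bar> < \<delta> / 2}"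
  have Wsmall: "\<bar>v i\<bar> < \<delta> / 2" if "v \<in> W" for v i
    using that \<delta>(1) by (cases "i < k") (auto simp: W_def topspace_Euclidean_space)
  have openW: "openin (Euclidean_space k) W"
    unfolding W_def by (rule openin_Euclidean_space_box)
  have WE: "v \<in> topspace (Euclidean_space k)" if "v \<in> W" for v
    using that by (simp add: W_def)
  have WU: "orbit_exp v \<in> U" if "v \<in> W" for v
  proof (rule \<delta>(2)[OF WE[OF that]])
    show "\<bar>v i\<bar> < \<delta>" for i
      using Wsmall[OF that, of i] \<delta>(1) by simp
  qed
  have injW: "inj_on orbit_exp W"
  proof (rule inj_onI)
    fix u v assume u: "u \<in> W" and v: "v \<in> W" and eq: "orbit_exp u = orbit_exp v"
    have mv: "(\<lambda>i. - v i) \<in> topspace (Euclidean_space k)"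
      using WE[OF v] by (simp add: topspace_Euclidean_space)
    have "orbit_exp (\<lambda>i. - v i + u i) = orbit_exp (\<lambda>i. - v i + v i)"
      using orbit_exp_add[OF mv WE[OF u]] orbit_exp_add[OF mv WE[OF v]] eq by simp
    also have "\<dots> = x0"
      using zero_in_stabilizer by (simp add: stabilizer_def)
    finally have "(\<lambda>i. - v i + u i) \<in> stabilizer"
      using WE[OF u] WE[OF v] by (simp add: stabilizer_def topspace_Euclidean_space)
    moreover have "\<bar>- v i + u i\<bar> < \<delta>" for i
      using Wsmall[OF u, of i] Wsmall[OF v, of i] by linarith
    ultimately have "- v i + u i = 0" for i
      using stabilizer_discrete[OF inj \<delta>(1,3), of "\<lambda>i. - v i + u i" i] by simp
    then have "u i = v i" for i by (simp add: add_eq_0_iff)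
    then show "u = v" by auto
  qed
  have "continuous_map (subtopology (Euclidean_space k) W) (subtopology X U) orbit_exp"
    using WU WE by (auto simp: continuous_map_in_subtopology intro!: continuous_map_from_subtopology continuous_map_orbit_exp)
  then have cont: "continuous_map (subtopology (Euclidean_space k) W) (Euclidean_space n) (h \<circ> orbit_exp)"
    by (rule continuous_map_compose) (use h homeomorphic_imp_continuous_map in blast)
  then have "continuous_map (subtopology (Euclidean_space k) W) (Euclidean_space k) (h \<circ> orbit_exp)"
    using nk unfolding Euclidean_space_def by (auto simp: continuous_map_in_subtopology Pi_iff)
  moreover have "inj_on (h \<circ> orbit_exp) W"
  proof (rule comp_inj_on[OF injW])
    have "inj_on h (topspace (subtopology X U))"
      using h homeomorphic_eq_everything_map by blast
    moreover have "orbit_exp ` W \<subseteq> topspace (subtopology X U)"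
      using WU openin_subset[OF U(1)] by auto
    ultimately show "inj_on h (orbit_exp ` W)" by (rule inj_on_subset)
  qed
  ultimately have "openin (Euclidean_space k) ((h \<circ> orbit_exp) ` W)"
    by (rule invariance_of_domain_Euclidean_space[OF openW])
  moreover have "(\<lambda>_. 0) \<in> W"
    using \<delta>(1) by (simp add: W_def topspace_Euclidean_space)
  then have "(h \<circ> orbit_exp) ` W \<noteq> {}" by blast
  moreover have "(h \<circ> orbit_exp) ` W \<subseteq> topspace (Euclidean_space n)"
    using cont WE by (force simp: continuous_map_def)
  ultimately show False
    using openin_Euclidean_space_not_subset nk by blast
qed

end

theorem theoremA:
  fixes X :: "'a topology" and n k :: nat and act :: "(nat \<Rightarrow> complex) \<Rightarrow> 'a \<Rightarrow> 'a" and x0 :: 'a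
  assumes "closed_manifold n X"
    and "k \<ge> 1"
    and "torus_action k X act"
    and "effective_action k X act"
    and "x0 \<in> topspace X"
    and "homologically_injective k X act x0"
  shows "(\<forall>j. enat (k choose j) \<le> betti j X) \<and> enat (2 ^ k) \<le> (\<Sum>j\<le>n. betti j X)"
proof -
  interpret torus_orbit k X act x0
    by standard (use assms in auto)
  note binomial = betti_ge_binomial[OF assms(6)]
  have enat_sum: "enat (\<Sum>j\<in>J. f j) = (\<Sum>j\<in>J. enat (f j))" for f :: "nat \<Rightarrow> nat" and J
    by (induction J rule: infinite_finite_induct) (auto simp: zero_enat_def simp flip: plus_enat_simps(1))
  have "enat (2 ^ k) = (\<Sum>j\<le>k. enat (k choose j))"
    by (simp add: choose_row_sum flip: enat_sum)
  also have "\<dots> \<le> (\<Sum>j\<le>k. betti j X)"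
    by (intro sum_mono binomial)
  \<comment> \<open>Enlarging the range of summation up to \<open>n\<close> is where
    \<open>k \<le> n\<close> enters.\<close>
  also have "\<dots> \<le> (\<Sum>j\<le>n. betti j X)"
    using dimension_bound[OF assms(6,1)] by (intro sum_mono2) auto
  finally show ?thesis
    using binomial by blast
qed

end
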